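(* There exists a constant $C_0$ such that most norms $\|\cdot\|$ on $\mathbb{R}^2$ satisfy $$u_{\|\cdot\|}(n) < C_0\, n\log n\log\log n \quad\text{for all } n\ge 3.$$ In particular, there exists a smooth and strictly convex norm $\|\cdot\|$ on $\mathbb{R}^2$ with this property.
   Context: Logarithms are in base $2$. For a norm $\|\cdot\|$ on $\mathbb{R}^2$, $u_{\|\cdot\|}(n)$ denotes the maximum, over all $n$-point sets $P\subset\mathbb{R}^2$, of the number of unordered pairs $\{p,p'\}\subseteq P$ with $\|p-p'\|=1$. Let $\mathcal{B}$ be the set of all unit balls of norms on $\mathbb{R}^2$, i.e., all closed bounded convex sets symmetric about $0$ with $0$ in the interior, equipped with the Hausdorff metric (with respect to the Euclidean distance). A set in a metric space is nowhere dense if every nonempty open set contains a nonempty open subset disjoint from it; a meager set is a countable union of nowhere dense sets. "Most norms have property $P$" means that the set of unit balls of norms not having property $P$ is a meager subset of $\mathcal{B}$. *)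

theory Defs
  imports "HOL-Analysis.Analysis"
begin

definition unit_balls :: "(real^2) set set" where
  "unit_balls = {K. closed K \<and> bounded K \<and> convex K \<and> (\<forall>x\<in>K. - x \<in> K) \<and> 0 \<in> interior K}"

definition ball_norm :: "(real^2) set \<Rightarrow> real^2 \<Rightarrow> real" where
  "ball_norm K x = Inf {t. 0 < t \<and> x \<in> (\<lambda>y. t *\<^sub>R y) ` K}"

definition hausdorff_dist :: "(real^2) set \<Rightarrow> (real^2) set \<Rightarrow> real" where
  "hausdorff_dist A B = max (SUP a\<in>A. infdist a B) (SUP b\<in>B. infdist b A)"

definition ub_open :: "(real^2) set set \<Rightarrow> bool" where
  "ub_open U \<longleftrightarrow> U \<subseteq> unit_balls \<and>
     (\<forall>K\<in>U. \<exists>e>0. \<forall>L\<in>unit_balls. hausdorff_dist K L < e \<longrightarrow> L \<in> U)"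

definition ub_nowhere_dense :: "(real^2) set set \<Rightarrow> bool" where
  "ub_nowhere_dense S \<longleftrightarrow>
     (\<forall>U. ub_open U \<and> U \<noteq> {} \<longrightarrow> (\<exists>V. ub_open V \<and> V \<noteq> {} \<and> V \<subseteq> U \<and> V \<inter> S = {}))"

definition ub_meager :: "(real^2) set set \<Rightarrow> bool" where
  "ub_meager S \<longleftrightarrow> (\<exists>N :: nat \<Rightarrow> (real^2) set set.
     (\<forall>i. ub_nowhere_dense (N i)) \<and> S \<subseteq> (\<Union>i. N i))"

definition unit_pairs :: "(real^2) set \<Rightarrow> (real^2) set \<Rightarrow> nat" where
  "unit_pairs K P = card {{p, q} | p q. p \<in> P \<and> q \<in> P \<and> ball_norm K (p - q) = 1}"

definition unit_dist_max :: "(real^2) set \<Rightarrow> nat \<Rightarrow> nat" where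
  "unit_dist_max K n = Max {unit_pairs K P | P. finite P \<and> card P = n}"

definition smooth_norm :: "(real^2) set \<Rightarrow> bool" where
  "smooth_norm K \<longleftrightarrow> (\<forall>x. x \<noteq> 0 \<longrightarrow> ball_norm K differentiable (at x))"

definition strictly_convex_norm :: "(real^2) set \<Rightarrow> bool" where
  "strictly_convex_norm K \<longleftrightarrow>
     (\<forall>x y. ball_norm K x = 1 \<and> ball_norm K y = 1 \<and> x \<noteq> y \<longrightarrow> ball_norm K ((1/2) *\<^sub>R (x + y)) < 1)"

end

theory Submission
  imports Defs
begin

text \<open>
Following Alon, Bucic and Sauermann: for a typical norm on the plane, every finite set of unit vectors without
antipodal pairs has at most twice as many elements as its rank over the rationals. Indeed, if
\<open>2m + 1\<close> unit vectors were rational combinations of \<open>m\<close> vectors, then after approximating the norm by a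
polygonal one with very short edges these vectors would solve \<open>2m + 1\<close> linear equations in \<open>2m\<close> unknowns,
and moving the edges a little destroys all solutions, robustly under further small changes of the norm.
Strict convexity and smoothness fail only on unions of countably many such robustly avoidable sets too, so a
Cauchy sequence of successive approximations yields a norm with all the properties at once.

Given the rank bound, weight each direction by the number of unit distances it carries. A greedy basis of the
matroid of rational independence carries at least half of the weight, and \<open>n\<close> points have at most
\<open>n log n\<close> differences in a rationally independent set of directions. This is even stronger than required,
as \<open>log (log n) > 1/2\<close> for \<open>n \<ge> 3\<close>.
\<close>

section \<open>Norms and their logarithmic distance\<close>

text \<open>Once it is fixed on which face of the polygon, and with which sign, each vector lies,
  its norm is a linear function of the unknown coordinates. With more vectors than coordinates, some
  nonzero combination of these functions vanishes identically, whereas the same combination of the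
  face heights becomes nonzero when the faces are shifted independently. The obstacle is that this
  independence needs different vectors on different faces: unit vectors close to each other may
  share an edge, and antipodal ones always belong to the same pair of opposite edges. Every
  forbidden condition therefore carries a lower bound 1/(n+1) on the distances up to sign, and the
  edges are made shorter than that bound. The rank is taken over the rationals because the matrices
  of coefficients must be countable in number; the edge count tolerates this, as it only needs
  additive coordinate functions. Norms are compared by ratios, so that errors multiply along a chain
  of approximations and the space is complete; on unit balls this gives the same topology as the
  Hausdorff metric.\<close>

definition is_norm :: "('a::real_vector \<Rightarrow> real) \<Rightarrow> bool" where
  "is_norm N \<longleftrightarrow> (\<forall>x y. N (x + y) \<le> N x + N y) \<and> (\<forall>c x. N (c *\<^sub>R x) = \<bar>c\<bar> * N x)
     \<and> (\<forall>x. x \<noteq> 0 \<longrightarrow> 0 < N x)"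

lemma is_norm_triangle: "is_norm N \<Longrightarrow> N (x + y) \<le> N x + N y"
  and is_norm_scaleR: "is_norm N \<Longrightarrow> N (c *\<^sub>R x) = \<bar>c\<bar> * N x"
  and is_norm_pos: "is_norm N \<Longrightarrow> x \<noteq> 0 \<Longrightarrow> 0 < N x"
  by (auto simp: is_norm_def)

lemma is_norm_zero: "is_norm N \<Longrightarrow> N 0 = 0"
  using is_norm_scaleR[of N 0 0] by simp

lemma is_norm_minus: "is_norm N \<Longrightarrow> N (- x) = N x"
  using is_norm_scaleR[of N "-1" x] by simp

lemma is_norm_nonneg: "is_norm N \<Longrightarrow> 0 \<le> N x"
  using is_norm_pos[of N x] is_norm_zero[of N] by (cases "x = 0") auto

lemma is_norm_diff_ineq: "is_norm N \<Longrightarrow> \<bar>N x - N y\<bar> \<le> N (x - y)"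
  using is_norm_triangle[of N "x - y" y] is_norm_triangle[of N "y - x" x]
    is_norm_minus[of N "x - y"] by (simp add: abs_le_iff)

lemma is_norm_sum: "is_norm N \<Longrightarrow> N (sum f A) \<le> (\<Sum>i\<in>A. N (f i))"
proof (induction A rule: infinite_finite_induct)
  case (insert x F)
  then show ?case using is_norm_triangle[of N "f x" "sum f F"] by auto
qed (auto simp: is_norm_zero)

lemma is_norm_midpoint: "is_norm N \<Longrightarrow> N ((1/2) *\<^sub>R (x + y)) \<le> (N x + N y) / 2"
  using is_norm_triangle[of N x y] by (simp add: is_norm_scaleR)

lemma is_norm_upper:
  fixes N :: "'a::euclidean_space \<Rightarrow> real"
  assumes "is_norm N"
  obtains B where "0 < B" "\<And>x. N x \<le> B * norm x"
proof
  show "0 < (\<Sum>b\<in>Basis. N b) + 1"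
    using assms by (simp add: add_nonneg_pos is_norm_nonneg sum_nonneg)
  fix x :: 'a
  have "N x = N (\<Sum>b\<in>Basis. (x \<bullet> b) *\<^sub>R b)" by (simp add: euclidean_representation)
  also have "\<dots> \<le> (\<Sum>b\<in>Basis. N ((x \<bullet> b) *\<^sub>R b))" by (rule is_norm_sum[OF assms])
  also have "\<dots> \<le> (\<Sum>b\<in>Basis. N b * norm x)"
    using assms by (intro sum_mono) (simp add: is_norm_scaleR mult.commute mult_left_mono Basis_le_norm is_norm_nonneg)
  also have "\<dots> \<le> ((\<Sum>b\<in>Basis. N b) + 1) * norm x"
    by (simp add: sum_distrib_right distrib_right)
  finally show "N x \<le> ((\<Sum>b\<in>Basis. N b) + 1) * norm x" .
qed

lemma is_norm_continuous:
  fixes N :: "'a::euclidean_space \<Rightarrow> real"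
  assumes "is_norm N"
  shows "continuous_on S N"
proof -
  obtain B where B: "0 < B" "\<And>x. N x \<le> B * norm x" using is_norm_upper[OF assms] by blast
  have "B-lipschitz_on S N"
    using B is_norm_diff_ineq[OF assms]
    by (intro lipschitz_onI) (auto simp: dist_norm intro: order_trans)
  then show ?thesis by (rule lipschitz_on_continuous_on)
qed

lemma is_norm_lower:
  fixes N :: "'a::euclidean_space \<Rightarrow> real"
  assumes "is_norm N"
  obtains b where "0 < b" "\<And>x. b * norm x \<le> N x"
proof -
  have "sphere (0::'a) 1 \<noteq> {}" by simp
  then obtain z where z: "z \<in> sphere 0 1" "\<And>y. y \<in> sphere 0 1 \<Longrightarrow> N z \<le> N y"
    using continuous_attains_inf[OF compact_sphere _ is_norm_continuous[OF assms]] by metis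
  show ?thesis
  proof
    show "0 < N z" using z(1) by (intro is_norm_pos[OF assms]) auto
    fix x :: 'a
    show "N z * norm x \<le> N x"
    proof (cases "x = 0")
      case False
      then have "N z \<le> N ((1 / norm x) *\<^sub>R x)" by (intro z(2)) simp
      then show ?thesis using False assms by (simp add: is_norm_scaleR field_simps)
    qed (simp add: is_norm_zero[OF assms])
  qed
qed

text \<open>For norms and nonzero vectors this says |ln \<open>N x\<close> - ln \<open>M x\<close>|
  \<le> \<open>d\<close>, so radii add under composition.\<close>

definition near :: "real \<Rightarrow> ('a \<Rightarrow> real) \<Rightarrow> ('a \<Rightarrow> real) \<Rightarrow> bool" where
  "near d N M \<longleftrightarrow> (\<forall>x. N x \<le> exp d * M x \<and> M x \<le> exp d * N x)"

lemma nearI: "(\<And>x. N x \<le> exp d * M x) \<Longrightarrow> (\<And>x. M x \<le> exp d * N x) \<Longrightarrow> near d N M"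
  and nearD1: "near d N M \<Longrightarrow> N x \<le> exp d * M x"
  and nearD2: "near d N M \<Longrightarrow> M x \<le> exp d * N x"
  by (auto simp: near_def)

lemma near_refl: "near 0 N N"
  by (auto simp: near_def)

lemma near_trans:
  assumes "near d N M" "near e M L"
  shows "near (d + e) N L"
proof (rule nearI)
  fix x
  have "N x \<le> exp d * (exp e * L x)"
    using nearD1[OF assms(1), of x] nearD1[OF assms(2), of x]
    by (meson exp_ge_zero mult_left_mono order_trans)
  then show "N x \<le> exp (d + e) * L x" by (simp add: exp_add mult.assoc)
  have "L x \<le> exp e * (exp d * N x)"
    using nearD2[OF assms(1), of x] nearD2[OF assms(2), of x]
    by (meson exp_ge_zero mult_left_mono order_trans)
  then show "L x \<le> exp (d + e) * N x" by (simp add: exp_add mult_ac)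
qed

lemma near_mono:
  assumes "near d N M" "is_norm N" "is_norm M" "d \<le> e"
  shows "near e N M"
proof (rule nearI)
  fix x
  have "exp d * M x \<le> exp e * M x" "exp d * N x \<le> exp e * N x"
    using assms by (simp_all add: mult_right_mono is_norm_nonneg)
  then show "N x \<le> exp e * M x" "M x \<le> exp e * N x"
    using nearD1[OF assms(1), of x] nearD2[OF assms(1), of x] by auto
qed

section \<open>Robustly avoidable conditions and a Baire category argument\<close>

text \<open>Nowhere density with respect to \<open>near\<close>, spelled out with balls. The ball
  around \<open>L\<close> need not lie inside the one around \<open>N\<close>; users halve
  \<open>d\<close> and shrink \<open>e\<close> to achieve this.\<close>

definition avoidable :: "(('a::real_vector \<Rightarrow> real) \<Rightarrow> bool) \<Rightarrow> bool" where
  "avoidable T \<longleftrightarrow> (\<forall>N d. is_norm N \<longrightarrow> 0 < d \<longrightarrow>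
     (\<exists>L e. is_norm L \<and> near d N L \<and> 0 < e \<and> (\<forall>M. is_norm M \<longrightarrow> near e L M \<longrightarrow> \<not> T M)))"

text \<open>A pointwise limit of norms is in general only a seminorm; staying within a fixed factor
  of \<open>f 0\<close> keeps it positive off the origin.\<close>

lemma is_norm_limit:
  assumes norm: "\<And>i. is_norm (f i)" and lim: "\<And>x. (\<lambda>i. f i x) \<longlonglongrightarrow> L x"
    and near: "\<And>i. near d (f 0) (f i)"
  shows "is_norm L"
  unfolding is_norm_def
proof (intro conjI allI impI)
  fix x y :: 'a and c :: real
  show "L (x + y) \<le> L x + L y"
    by (rule LIMSEQ_le[OF lim tendsto_add[OF lim lim]]) (auto intro: is_norm_triangle[OF norm])
  have "(\<lambda>i. f i (c *\<^sub>R x)) \<longlonglongrightarrow> \<bar>c\<bar> * L x"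
    using tendsto_mult[OF tendsto_const lim] by (simp add: is_norm_scaleR[OF norm])
  then show "L (c *\<^sub>R x) = \<bar>c\<bar> * L x" using lim LIMSEQ_unique by blast
  assume "x \<noteq> 0"
  have "f 0 x \<le> exp d * L x"
    by (rule LIMSEQ_le[OF tendsto_const tendsto_mult[OF tendsto_const lim]]) (auto intro: nearD1[OF near])
  then show "0 < L x"
    using is_norm_pos[OF norm \<open>x \<noteq> 0\<close>, of 0] by (smt (verit) exp_gt_zero zero_less_mult_pos)
qed

lemma near_limit:
  assumes "\<And>x. (\<lambda>i. f i x) \<longlonglongrightarrow> L x" "\<And>i. i \<ge> k \<Longrightarrow> near d N (f i)"
  shows "near d N L"
proof (rule nearI)
  fix x
  show "N x \<le> exp d * L x"
    by (rule LIMSEQ_le[OF tendsto_const tendsto_mult[OF tendsto_const assms(1)]])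
      (use nearD1[OF assms(2)] in blast)
  show "L x \<le> exp d * N x"
    by (rule LIMSEQ_le[OF assms(1) tendsto_const]) (use nearD2[OF assms(2)] in blast)
qed

text \<open>After taking logarithms of the values at a fixed nonzero vector, \<open>near\<close>
  becomes an ordinary Cauchy estimate.\<close>

lemma near_Cauchy_convergent:
  assumes norm: "\<And>i. is_norm (f i)" and d: "d \<longlonglongrightarrow> 0"
    and near: "\<And>i j. i \<le> j \<Longrightarrow> near (d i) (f i) (f j)"
  shows "convergent (\<lambda>i. f i x)"
proof (cases "x = 0")
  case False
  have pos: "0 < f i x" for i using is_norm_pos[OF norm False] .
  have "Cauchy (\<lambda>i. ln (f i x))"
  proof (rule CauchyI')
    fix e :: real assume "0 < e"
    then obtain k where k: "\<And>i. i \<ge> k \<Longrightarrow> \<bar>d i\<bar> < e"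
      using LIMSEQ_D[OF d] by (auto simp: real_norm_def)
    have "dist (ln (f i x)) (ln (f j x)) < e" if "i \<ge> k" "j > i" for i j
    proof -
      have "ln (f i x) \<le> ln (exp (d i) * f j x)" "ln (f j x) \<le> ln (exp (d i) * f i x)"
        using nearD1[OF near[of i j], of x] nearD2[OF near[of i j], of x] that pos by auto
      then show ?thesis using k[OF that(1)] pos[of i] pos[of j] by (simp add: ln_mult_pos dist_real_def abs_le_iff abs_less_iff)
    qed
    then show "\<exists>M. \<forall>m\<ge>M. \<forall>n>m. dist (ln (f m x)) (ln (f n x)) < e" by blast
  qed
  then obtain l where "(\<lambda>i. ln (f i x)) \<longlonglongrightarrow> l"
    using Cauchy_convergent convergent_def by blast
  then have "(\<lambda>i. exp (ln (f i x))) \<longlonglongrightarrow> exp l" by (rule tendsto_exp)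
  then show ?thesis using pos by (auto simp: convergent_def)
qed (simp add: is_norm_zero[OF norm] convergent_const)

text \<open>Nested balls: a pair \<open>(L, e)\<close> is a ball on which one more condition fails,
  and \<open>Q\<close> places it inside the preceding ball.\<close>

lemma exists_norm_avoiding:
  fixes T :: "nat \<Rightarrow> ('a::real_vector \<Rightarrow> real) \<Rightarrow> bool"
  assumes T: "\<And>i. avoidable (T i)" and ex: "is_norm (N0 :: 'a \<Rightarrow> real)"
  obtains N where "is_norm N" "\<And>i. \<not> T i N"
proof -
  define P where "P = (\<lambda>i (L, e). is_norm L \<and> 0 < e \<and> (\<forall>M. is_norm M \<longrightarrow> near e L M \<longrightarrow> \<not> T i M))"
  define Q where "Q = (\<lambda>(N :: 'a \<Rightarrow> real, d) (L, e). near (d / 2) N L \<and> e \<le> d / (2::real))"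
  have step: "\<exists>q. P i q \<and> Q p q" if p: "is_norm (fst p)" "0 < snd p" for p i
  proof -
    obtain L e where L: "is_norm L" "near (snd p / 2) (fst p) L" "0 < e"
      "\<And>M. is_norm M \<Longrightarrow> near e L M \<Longrightarrow> \<not> T i M"
      using T[of i, unfolded avoidable_def, rule_format, of "fst p" "snd p / 2"] p by auto
    then have "P i (L, min e (snd p / 2))"
      using that near_mono[of "min e (snd p / 2)" L _ e] by (auto simp: P_def)
    moreover have "Q p (L, min e (snd p / 2))"
      using L by (auto simp: Q_def split: prod.splits)
    ultimately show ?thesis by blast
  qed
  have "\<exists>g. \<forall>i. P i (g i) \<and> Q (g i) (g (Suc i))"
  proof (rule dependent_nat_choice)
    show "\<exists>p. P 0 p" using step[of "(N0, 1)" 0] ex by auto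
    show "\<exists>q. P (Suc i) q \<and> Q p q" if "P i p" for p i
      using step[of p "Suc i"] that by (auto simp: P_def split: prod.splits)
  qed
  then obtain g where gP: "\<And>i. P i (g i)" and gQ: "\<And>i. Q (g i) (g (Suc i))" by blast
  define f where "f = (\<lambda>i. fst (g i))"
  define d where "d = (\<lambda>i. snd (g i))"
  have norm: "is_norm (f i)" and dpos: "0 < d i"
    and avoid: "\<And>M. is_norm M \<Longrightarrow> near (d i) (f i) M \<Longrightarrow> \<not> T i M" for i
    using gP[of i] by (auto simp: P_def f_def d_def split: prod.splits)
  have next_near: "near (d i / 2) (f i) (f (Suc i))" and half: "d (Suc i) \<le> d i / 2" for i
    using gQ[of i] by (auto simp: Q_def f_def d_def split: prod.splits)
  \<comment> \<open>Stated as a difference of radii, the drift telescopes: the next move costs at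
    most \<open>d (i + k) / 2\<close>, and the radius drops by at least that much.\<close>
  have near': "near (d i - d (i + k)) (f i) (f (i + k))" for i k
  proof (induction k)
    case (Suc k)
    have "near (d i - d (i + k) + d (i + k) / 2) (f i) (f (Suc (i + k)))"
      by (rule near_trans[OF Suc.IH next_near])
    from near_mono[OF this norm norm] show ?case using half[of "i + k"] by simp
  qed (simp add: near_refl)
  have near: "near (d i) (f i) (f j)" if "i \<le> j" for i j
    using near_mono[OF near'[of i "j - i"] norm norm, of "d i"] that dpos[of j] by simp
  have d_le: "d i \<le> d 0 * (1/2) ^ i" for i
    by (induction i) (use half in \<open>auto intro: order_trans\<close>)
  have lim0: "(\<lambda>i. d 0 * (1/2) ^ i) \<longlonglongrightarrow> 0"
    by (rule tendsto_mult_right_zero[OF LIMSEQ_power_zero]) simp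
  have "d \<longlonglongrightarrow> 0"
    by (rule real_tendsto_sandwich[OF _ _ tendsto_const lim0])
      (simp_all add: d_le dpos less_imp_le)
  then have "convergent (\<lambda>i. f i x)" for x
    by (intro near_Cauchy_convergent[where d = d]) (simp_all add: norm near)
  then obtain L where lim: "\<And>x. (\<lambda>i. f i x) \<longlonglongrightarrow> L x" unfolding convergent_def by metis
  have "is_norm L"
    by (rule is_norm_limit[where f = f and d = "d 0"]) (simp_all add: norm lim near)
  moreover have "near (d i) (f i) L" for i
    by (rule near_limit[where f = f and k = i]) (simp_all add: lim near)
  ultimately show ?thesis using avoid that by blast
qed

section \<open>Strictly convex and smooth norms\<close>

text \<open>Separate \<open>x\<close> from the open ball of radius \<open>N x\<close> and rescale
  the separating functional to take the value \<open>N x\<close> at \<open>x\<close>.\<close>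

lemma is_norm_subgradient:
  fixes N :: "'a::euclidean_space \<Rightarrow> real"
  assumes N: "is_norm N"
  obtains w where "w \<bullet> x = N x" "\<And>h. w \<bullet> h \<le> N h"
proof (cases "x = 0")
  case True
  then show ?thesis using that[of 0] is_norm_zero[OF N] is_norm_nonneg[OF N] by simp
next
  case False
  define S where "S = {y. N y < N x}"
  have Nx: "0 < N x" using is_norm_pos[OF N False] .
  have "convex S"
    unfolding convex_alt
  proof (intro ballI allI impI)
    fix y z and u :: real
    assume yz: "y \<in> S" "z \<in> S" and u: "0 \<le> u \<and> u \<le> 1"
    have "N ((1 - u) *\<^sub>R y + u *\<^sub>R z) \<le> (1 - u) * N y + u * N z"
      using is_norm_triangle[OF N, of "(1 - u) *\<^sub>R y" "u *\<^sub>R z"] u by (simp add: is_norm_scaleR[OF N])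
    also have "\<dots> < N x"
      using yz u by (intro convex_bound_lt) (auto simp: S_def)
    finally show "(1 - u) *\<^sub>R y + u *\<^sub>R z \<in> S" by (simp add: S_def)
  qed
  moreover have "0 \<in> S" using Nx by (simp add: S_def is_norm_zero[OF N])
  ultimately obtain a b where a: "a \<noteq> 0" "\<forall>y\<in>S. a \<bullet> y \<le> b" "b \<le> a \<bullet> x"
    using separating_hyperplane_sets[of S "{x}"] by (auto simp: S_def)
  have le: "a \<bullet> y \<le> a \<bullet> x" if "N y < N x" for y
    using a that by (force simp: S_def)
  have Na: "0 < N a" using is_norm_pos[OF N a(1)] .
  have "a \<bullet> ((N x / (2 * N a)) *\<^sub>R a) \<le> a \<bullet> x"
    using Na Nx by (intro le) (simp add: is_norm_scaleR[OF N])
  moreover have "0 < a \<bullet> ((N x / (2 * N a)) *\<^sub>R a)" using Na Nx a(1) by simp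
  ultimately have ax: "0 < a \<bullet> x" by linarith
  show ?thesis
  proof
    show "((N x / (a \<bullet> x)) *\<^sub>R a) \<bullet> x = N x" using ax by simp
    fix h
    show "((N x / (a \<bullet> x)) *\<^sub>R a) \<bullet> h \<le> N h"
    proof (cases "h = 0")
      case False
      then have Nh: "0 < N h" using is_norm_pos[OF N] by blast
      have "N x / N h * (a \<bullet> h) \<le> a \<bullet> x"
      proof (rule field_le_mult_one_interval)
        \<comment> \<open>The separation covers only vectors of norm strictly below
          \<open>N x\<close>, so \<open>h\<close> is scaled to norm \<open>z * N x\<close> and
          \<open>z\<close> tends to 1.\<close>
        fix z :: real assume z: "0 < z" "z < 1"
        have "a \<bullet> ((z * N x / N h) *\<^sub>R h) \<le> a \<bullet> x"
          using Nh Nx z by (intro le) (simp add: is_norm_scaleR[OF N])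
        then show "z * (N x / N h * (a \<bullet> h)) \<le> a \<bullet> x" by simp
      qed
      then show ?thesis using ax Nh by (simp add: field_simps)
    qed (simp add: is_norm_zero[OF N])
  qed
qed

lemma exp_diff_small:
  fixes b g k :: real
  assumes "0 < b" "0 < g"
  obtains e where "0 < e" "e < b" "exp (k * e) - exp (- (k * e)) < g"
proof -
  have "((\<lambda>e. exp (k * e) - exp (- (k * e))) \<longlongrightarrow> exp (k * 0) - exp (- (k * 0))) (at_right 0)"
    by (intro tendsto_intros)
  then have "eventually (\<lambda>e. exp (k * e) - exp (- (k * e)) < g) (at_right 0)"
    using assms by (intro order_tendstoD(2)[where y = "exp (k * 0) - exp (- (k * 0))"]) auto
  moreover have "eventually (\<lambda>e. e \<in> {0<..<b}) (at_right 0)"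
    using assms(1) by (rule eventually_at_right_real)
  ultimately have "eventually (\<lambda>e. e \<in> {0<..<b} \<and> exp (k * e) - exp (- (k * e)) < g) (at_right 0)"
    by (rule eventually_elim2) simp
  then obtain e where "e \<in> {0<..<b} \<and> exp (k * e) - exp (- (k * e)) < g"
    using eventually_happens'[OF trivial_limit_at_right_real] by blast
  then show ?thesis using that[of e] by simp
qed

section \<open>Uniformly convex approximation\<close>

text \<open>Adding a small multiple of the squared Euclidean norm to the square of \<open>N\<close>
  gives the square of a norm, and the parallelogram law for the added term supplies the quadratic
  gain at midpoints.\<close>

lemma near_uniformly_convex:
  fixes N :: "'a::euclidean_space \<Rightarrow> real"
  assumes N: "is_norm N" and d: "0 < d"
  obtains P c where "is_norm P" "near d N P" "0 < c"
    "\<And>x y. c * (norm (x - y))\<^sup>2 \<le> ((P x)\<^sup>2 + (P y)\<^sup>2) / 2 - (P ((1/2) *\<^sub>R (x + y)))\<^sup>2"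
proof -
  obtain b where b: "0 < b" "\<And>x. b * norm x \<le> N x" using is_norm_lower[OF N] by blast
  \<comment> \<open>With this value the added term \<open>(c * norm x)\<^sup>2\<close> is at most
    \<open>(exp (2 * d) - 1) * (N x)\<^sup>2\<close>, as needed for
    \<open>P x \<le> exp d * N x\<close>.\<close>
  define c where "c = b * sqrt (exp (2 * d) - 1)"
  have c: "0 < c" using b d by (simp add: c_def)
  define P where "P = (\<lambda>x. sqrt ((N x)\<^sup>2 + (c * norm x)\<^sup>2))"
  have P2: "(P x)\<^sup>2 = (N x)\<^sup>2 + (c * norm x)\<^sup>2" for x by (simp add: P_def)
  show ?thesis
  proof
    show "is_norm P"
      unfolding is_norm_def
    proof (intro conjI allI impI)
      fix x y :: 'a and a :: real
      have "P (x + y) \<le> sqrt ((N x + N y)\<^sup>2 + (c * norm x + c * norm y)\<^sup>2)"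
        unfolding P_def using c norm_triangle_ineq[of x y]
        by (intro real_sqrt_le_mono add_mono power_mono is_norm_triangle[OF N])
          (auto simp: is_norm_nonneg[OF N] simp flip: distrib_left)
      also have "\<dots> \<le> P x + P y" unfolding P_def by (rule real_sqrt_sum_squares_triangle_ineq)
      finally show "P (x + y) \<le> P x + P y" .
      show "P (a *\<^sub>R x) = \<bar>a\<bar> * P x"
        by (rule power2_eq_imp_eq) (auto simp: P2 power_mult_distrib is_norm_scaleR[OF N] algebra_simps P_def)
      assume "x \<noteq> 0"
      then show "0 < P x" using c by (simp add: P_def add_nonneg_pos)
    qed
    show "near d N P"
    proof (rule nearI)
      fix x
      have "N x \<le> P x" by (simp add: P_def real_le_rsqrt)
      moreover have "P x \<le> exp d * P x" using d by (simp add: P_def mult_le_cancel_right1 not_less)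
      ultimately show "N x \<le> exp d * P x" by linarith
      have "(b * norm x)\<^sup>2 \<le> (N x)\<^sup>2" using b by (intro power_mono) auto
      then have "(exp (2 * d) - 1) * (b * norm x)\<^sup>2 \<le> (exp (2 * d) - 1) * (N x)\<^sup>2"
        using d by (intro mult_left_mono) auto
      moreover have "(c * norm x)\<^sup>2 = (exp (2 * d) - 1) * (b * norm x)\<^sup>2"
        using d by (simp add: c_def power_mult_distrib)
      ultimately have "(N x)\<^sup>2 + (c * norm x)\<^sup>2 \<le> exp (2 * d) * (N x)\<^sup>2" by (simp add: algebra_simps)
      also have "\<dots> = (exp d * N x)\<^sup>2" by (simp add: power_mult_distrib exp_double)
      finally have "P x \<le> sqrt ((exp d * N x)\<^sup>2)" unfolding P_def by (rule real_sqrt_le_mono)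
      then show "P x \<le> exp d * N x" using is_norm_nonneg[OF N, of x] by simp
    qed
    show "0 < (c / 2)\<^sup>2" using c by simp
    fix x y :: 'a
    let ?m = "(1/2) *\<^sub>R (x + y)"
    have "(N ?m)\<^sup>2 \<le> ((N x + N y) / 2)\<^sup>2"
      by (intro power_mono is_norm_midpoint is_norm_nonneg N)
    also have "\<dots> \<le> ((N x)\<^sup>2 + (N y)\<^sup>2) / 2"
      using sum_squares_bound[of "N x" "N y"] by (simp add: power2_eq_square field_simps)
    finally have 1: "(N ?m)\<^sup>2 \<le> ((N x)\<^sup>2 + (N y)\<^sup>2) / 2" .
    have 2: "(norm ?m)\<^sup>2 = ((norm x)\<^sup>2 + (norm y)\<^sup>2) / 2 - (norm (x - y))\<^sup>2 / 4"
      by (simp add: power2_norm_eq_inner inner_add_left inner_add_right inner_diff_left inner_diff_right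
          inner_commute field_simps)
    show "(c / 2)\<^sup>2 * (norm (x - y))\<^sup>2 \<le> ((P x)\<^sup>2 + (P y)\<^sup>2) / 2 - (P ?m)\<^sup>2"
      unfolding P2 power_mult_distrib 2 using 1 by (simp add: power2_eq_square field_simps)
  qed
qed

text \<open>For fixed \<open>r\<close>, uniform convexity lowers the squared norm of the midpoint by
  at least \<open>c * r\<^sup>2\<close>, a gap that a change of ratio \<open>exp e\<close> with
  small \<open>e\<close> cannot close.\<close>

lemma avoidable_not_strictly_convex:
  fixes r :: real
  assumes "0 < r"
  shows "avoidable (\<lambda>N :: 'a::euclidean_space \<Rightarrow> real.
    \<exists>x y. N x = 1 \<and> N y = 1 \<and> N ((1/2) *\<^sub>R (x + y)) = 1 \<and> r \<le> norm (x - y))"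
  unfolding avoidable_def
proof (intro allI impI)
  fix N :: "'a \<Rightarrow> real" and d :: real
  assume "is_norm N" "0 < d"
  then obtain P c where P: "is_norm P" "near d N P" "0 < c"
    "\<And>x y. c * (norm (x - y))\<^sup>2 \<le> ((P x)\<^sup>2 + (P y)\<^sup>2) / 2 - (P ((1/2) *\<^sub>R (x + y)))\<^sup>2"
    using near_uniformly_convex by blast
  obtain e where e: "0 < e" "exp (2 * e) - exp (- (2 * e)) < c * r\<^sup>2"
    using exp_diff_small[of 1 "c * r\<^sup>2" 2] P(3) assms by auto
  have False if M: "near e P M" "M x = 1" "M y = 1" "M ((1/2) *\<^sub>R (x + y)) = 1" "r \<le> norm (x - y)"
    for M x y
  proof -
    let ?m = "(1/2) *\<^sub>R (x + y)"
    have "P x \<le> exp e" "P y \<le> exp e" using nearD1[OF M(1), of x] nearD1[OF M(1), of y] M by auto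
    then have "(P x)\<^sup>2 \<le> exp (2 * e)" "(P y)\<^sup>2 \<le> exp (2 * e)"
      by (simp_all add: exp_double power_mono is_norm_nonneg[OF P(1)])
    moreover have "exp (- e) \<le> P ?m" using nearD2[OF M(1), of ?m] M(4) by (simp add: exp_minus field_simps)
    then have "(exp (- e))\<^sup>2 \<le> (P ?m)\<^sup>2" by (intro power_mono) auto
    then have "exp (- (2 * e)) \<le> (P ?m)\<^sup>2" using exp_double[of "- e"] by simp
    moreover have "c * r\<^sup>2 \<le> c * (norm (x - y))\<^sup>2"
      using P(3) M(5) assms by (intro mult_left_mono power_mono) auto
    moreover have "c * r\<^sup>2 \<le> ((P x)\<^sup>2 + (P y)\<^sup>2) / 2 - (P ?m)\<^sup>2"
      using \<open>c * r\<^sup>2 \<le> c * (norm (x - y))\<^sup>2\<close> P(4)[of x y] by (rule order_trans)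
    ultimately show False using e(2) by argo
  qed
  then show "\<exists>L e. is_norm L \<and> near d N L \<and> 0 < e \<and> (\<forall>M. is_norm M \<longrightarrow> near e L M \<longrightarrow>
      \<not> (\<exists>x y. M x = 1 \<and> M y = 1 \<and> M ((1/2) *\<^sub>R (x + y)) = 1 \<and> r \<le> norm (x - y)))"
    using P(1,2) e(1) by blast
qed

section \<open>Uniformly smooth approximation and differentiability\<close>

text \<open>The Cauchy-Schwarz inequality for \<open>(a, p)\<close> and
  \<open>(1, k)\<close>.\<close>

lemma add_mult_le_sqrt:
  fixes a p k :: real
  shows "a + p * k \<le> sqrt ((a\<^sup>2 + p\<^sup>2) * (1 + k\<^sup>2))"
  using zero_le_power2[of "a * k - p"]
  by (intro real_le_rsqrt) (simp add: power2_eq_square algebra_simps)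

text \<open>Dual to the convex case: the square of \<open>S\<close> is the Moreau envelope of the
  square of \<open>N\<close>, its infimal convolution with a multiple of the squared Euclidean norm.
  Using the same \<open>z\<close> for \<open>x + y\<close> and \<open>x - y\<close> leaves only the
  Euclidean part to vary, and the parallelogram law evaluates its second difference.\<close>

lemma near_uniformly_smooth:
  fixes N :: "'a::euclidean_space \<Rightarrow> real"
  assumes N: "is_norm N" and d: "0 < d"
  obtains S C where "is_norm S" "near d N S" "0 < C"
    "\<And>x y. (S (x + y))\<^sup>2 + (S (x - y))\<^sup>2 \<le> 2 * (S x)\<^sup>2 + C * (norm y)\<^sup>2"
proof -
  obtain B where B: "0 < B" "\<And>x. N x \<le> B * norm x" using is_norm_upper[OF N] by blast
  \<comment> \<open>Makes \<open>1 + (B / c)\<^sup>2\<close> equal to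
    \<open>(exp d)\<^sup>2\<close>, so that the Cauchy-Schwarz estimate of \<open>N x\<close> by
    \<open>F z x\<close> loses exactly the factor \<open>exp d\<close>.\<close>
  define c where "c = B / sqrt (exp (2 * d) - 1)"
  have c: "0 < c" using B d by (simp add: c_def)
  define F where "F = (\<lambda>z x. sqrt ((N z)\<^sup>2 + (c * norm (x - z))\<^sup>2))"
  define S where "S = (\<lambda>x. INF z. F z x)"
  have F0: "0 \<le> F z x" and F2: "(F z x)\<^sup>2 = (N z)\<^sup>2 + c\<^sup>2 * (norm (x - z))\<^sup>2" for z x
    by (simp_all add: F_def power_mult_distrib)
  have bdd: "bdd_below (range (\<lambda>z. F z x))" for x by (rule bdd_belowI2[of _ 0]) (rule F0)
  have S_le: "S x \<le> F z x" for x z unfolding S_def by (rule cINF_lower[OF bdd]) simp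
  have S_ge: "t \<le> S x" if "\<And>z. t \<le> F z x" for t x unfolding S_def by (rule cINF_greatest) (use that in auto)
  have S_approx: "\<exists>z. F z x < S x + e" if "0 < e" for x e
    using S_ge[of "S x + e" x] that by (metis add_le_same_cancel1 not_le)
  have S0: "0 \<le> S x" for x using S_ge F0 by blast
  have N_le: "N x \<le> exp d * S x" for x
  proof -
    have "N x / exp d \<le> F z x" for z
    proof -
      have "N x \<le> N z + N (x - z)" using is_norm_triangle[OF N, of z "x - z"] by simp
      also have "\<dots> \<le> N z + B * norm (x - z)" using B by simp
      also have "\<dots> = N z * 1 + (c * norm (x - z)) * (B / c)" using c by simp
      also have "\<dots> \<le> sqrt (((N z)\<^sup>2 + (c * norm (x - z))\<^sup>2) * (1 + (B / c)\<^sup>2))"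
        using add_mult_le_sqrt[of "N z" "c * norm (x - z)" "B / c"] by simp
      also have "\<dots> = F z x * sqrt (1 + (B / c)\<^sup>2)" by (simp add: F_def real_sqrt_mult)
      also have "1 + (B / c)\<^sup>2 = (exp d)\<^sup>2" using B d by (simp add: c_def exp_double)
      finally show ?thesis by (simp add: field_simps)
    qed
    then show ?thesis using S_ge[of "N x / exp d" x] by (simp add: field_simps)
  qed
  have S_scale: "S (a *\<^sub>R x) \<le> \<bar>a\<bar> * S x" for a x
  proof (cases "a = 0")
    case True
    have "S 0 \<le> F 0 0" by (rule S_le)
    then show ?thesis using True by (simp add: F_def is_norm_zero[OF N])
  next
    case False
    have "S (a *\<^sub>R x) / \<bar>a\<bar> \<le> F z x" for z
    proof -
      have "F (a *\<^sub>R z) (a *\<^sub>R x) = \<bar>a\<bar> * F z x"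
        by (rule power2_eq_imp_eq)
          (simp_all add: F_def power_mult_distrib is_norm_scaleR[OF N] distrib_left mult_ac
            flip: scaleR_right_diff_distrib)
      then show ?thesis using S_le[of "a *\<^sub>R x" "a *\<^sub>R z"] False by (simp add: field_simps)
    qed
    then show ?thesis using S_ge[of "S (a *\<^sub>R x) / \<bar>a\<bar>" x] False by (simp add: field_simps)
  qed
  show ?thesis
  proof
    show "is_norm S"
      unfolding is_norm_def
    proof (intro conjI allI impI)
      fix x y :: 'a and a :: real
      show "S (x + y) \<le> S x + S y"
      proof (rule field_le_epsilon)
        fix e :: real assume "0 < e"
        then obtain u v where u: "F u x < S x + e / 2" and v: "F v y < S y + e / 2"
          using S_approx[of "e / 2"] by fastforce
        have cn: "c * norm (x + y - (u + v)) \<le> c * norm (x - u) + c * norm (y - v)"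
          using mult_left_mono[OF norm_triangle_ineq, of c "x - u" "y - v"] c
          by (simp add: distrib_left add_diff_add)
        have "F (u + v) (x + y) \<le> sqrt ((N u + N v)\<^sup>2 + (c * norm (x - u) + c * norm (y - v))\<^sup>2)"
          unfolding F_def using c cn
          by (auto intro!: real_sqrt_le_mono add_mono power_mono is_norm_triangle[OF N] simp: is_norm_nonneg[OF N])
        also have "\<dots> \<le> F u x + F v y" unfolding F_def by (rule real_sqrt_sum_squares_triangle_ineq)
        finally show "S (x + y) \<le> S x + S y + e" using u v S_le[of "x + y" "u + v"] by linarith
      qed
      show "S (a *\<^sub>R x) = \<bar>a\<bar> * S x"
      proof (cases "a = 0")
        case False
        have "S ((1 / a) *\<^sub>R (a *\<^sub>R x)) \<le> \<bar>1 / a\<bar> * S (a *\<^sub>R x)" by (rule S_scale)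
        then show ?thesis using False S_scale[of a x] by (simp add: field_simps)
      qed (use S_scale[of 0 x] S0[of 0] in simp)
      assume "x \<noteq> 0"
      then have "S x \<noteq> 0" using N_le[of x] is_norm_pos[OF N, of x] by auto
      then show "0 < S x" using S0[of x] by simp
    qed
    show "near d N S"
    proof (rule nearI[OF N_le])
      fix x
      have "S x \<le> F x x" by (rule S_le)
      also have "F x x = N x" by (simp add: F_def is_norm_nonneg[OF N])
      also have "\<dots> \<le> exp d * N x" using d is_norm_nonneg[OF N, of x] by (simp add: mult_le_cancel_right1)
      finally show "S x \<le> exp d * N x" .
    qed
    show "0 < 2 * c\<^sup>2" using c by simp
    fix x y :: 'a
    have le: "(S (x + y))\<^sup>2 + (S (x - y))\<^sup>2 \<le> 2 * (S x + e)\<^sup>2 + 2 * c\<^sup>2 * (norm y)\<^sup>2" if e: "0 < e" for e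
    proof -
      obtain z where z: "F z x < S x + e" using S_approx[OF e] by blast
      have "(S (x + y))\<^sup>2 + (S (x - y))\<^sup>2 \<le> (F z (x + y))\<^sup>2 + (F z (x - y))\<^sup>2"
        by (intro add_mono power_mono S_le S0)
      also have "\<dots> = 2 * (F z x)\<^sup>2 + 2 * c\<^sup>2 * (norm y)\<^sup>2"
        by (simp add: F2 power2_norm_eq_inner inner_add_left inner_add_right
          inner_diff_left inner_diff_right inner_commute algebra_simps)
      also have "\<dots> \<le> 2 * (S x + e)\<^sup>2 + 2 * c\<^sup>2 * (norm y)\<^sup>2"
        using z F0[of z x] by (simp add: power_mono)
      finally show ?thesis .
    qed
    have "((\<lambda>e. 2 * (S x + e)\<^sup>2 + 2 * c\<^sup>2 * (norm y)\<^sup>2) \<longlongrightarrow> 2 * (S x + 0)\<^sup>2 + 2 * c\<^sup>2 * (norm y)\<^sup>2) (at_right 0)"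
      by (intro tendsto_intros)
    then have "(S (x + y))\<^sup>2 + (S (x - y))\<^sup>2 \<le> 2 * (S x + 0)\<^sup>2 + 2 * c\<^sup>2 * (norm y)\<^sup>2"
      by (rule tendsto_lowerbound)
        (use le eventually_at_right_less[of "0::real"] in \<open>auto elim: eventually_mono\<close>)
    then show "(S (x + y))\<^sup>2 + (S (x - y))\<^sup>2 \<le> 2 * (S x)\<^sup>2 + 2 * c\<^sup>2 * (norm y)\<^sup>2" by simp
  qed
qed

text \<open>One scale \<open>t\<close> suffices to violate the condition: at a uniformly smooth norm
  second differences are of order \<open>t\<^sup>2\<close>, hence well below \<open>r * t\<close>
  for some fixed \<open>t\<close>, and at a fixed scale this survives small perturbations.\<close>

lemma avoidable_not_smooth:
  fixes r :: real
  assumes r: "0 < r"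
  shows "avoidable (\<lambda>N :: 'a::euclidean_space \<Rightarrow> real.
    \<forall>t. 0 < t \<longrightarrow> t < 1 \<longrightarrow> (\<exists>x y. N x = 1 \<and> N y = 1 \<and> r * t \<le> N (x + t *\<^sub>R y) + N (x - t *\<^sub>R y) - 2))"
  unfolding avoidable_def
proof (intro allI impI)
  fix N :: "'a \<Rightarrow> real" and d :: real
  assume "is_norm N" "0 < d"
  then obtain S C where S: "is_norm S" "near d N S" "0 < C"
    "\<And>x y. (S (x + y))\<^sup>2 + (S (x - y))\<^sup>2 \<le> 2 * (S x)\<^sup>2 + C * (norm y)\<^sup>2"
    using near_uniformly_smooth by blast
  obtain b where b: "0 < b" "\<And>x. b * norm x \<le> S x" using is_norm_lower[OF S(1)] by blast
  \<comment> \<open>Normalised so that \<open>S (x + t *\<^sub>R y) + S (x - t *\<^sub>R y) \<le> 2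
    * (1 + D * t\<^sup>2)\<close> for unit vectors of \<open>S\<close>. The scale \<open>t\<close>
    depends on \<open>D\<close> and \<open>r\<close>; only afterwards is \<open>e\<close>
    chosen.\<close>
  define D where "D = C / (4 * b\<^sup>2)"
  have D: "0 < D" using S(3) b by (simp add: D_def)
  define t where "t = min (1/2) (r / (8 * D))"
  have t: "0 < t" "t < 1" using r D by (auto simp: t_def)
  have "t \<le> r / (8 * D)" by (simp add: t_def)
  then have "8 * D * t \<le> r" using D by (simp add: field_simps)
  then have tD: "2 * (D * t\<^sup>2) \<le> r * t / 4" using mult_right_mono[of "8 * D * t" r t] t by (simp add: power2_eq_square)
  have "((\<lambda>e. exp (2 * e) * (2 + r * t / 4) - 2) \<longlongrightarrow> exp (2 * 0) * (2 + r * t / 4) - 2) (at_right 0)"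
    by (intro tendsto_intros)
  then have "eventually (\<lambda>e. exp (2 * e) * (2 + r * t / 4) - 2 < r * t) (at_right 0)"
    using r t by (intro order_tendstoD(2)[where y = "exp (2 * 0) * (2 + r * t / 4) - 2"]) auto
  moreover have "eventually (\<lambda>e::real. 0 < e) (at_right 0)" by (rule eventually_at_right_less)
  ultimately have "eventually (\<lambda>e. 0 < e \<and> exp (2 * e) * (2 + r * t / 4) - 2 < r * t) (at_right 0)"
    by (rule eventually_elim2) simp
  then obtain e where e: "0 < e" "exp (2 * e) * (2 + r * t / 4) - 2 < r * t"
    using eventually_happens' trivial_limit_at_right_real by blast
  have False if M: "near e S M" "M x = 1" "M y = 1" "r * t \<le> M (x + t *\<^sub>R y) + M (x - t *\<^sub>R y) - 2" for M x y
  proof -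
    have Sx: "S x \<le> exp e" and Sy: "S y \<le> exp e"
      using nearD1[OF M(1), of x] nearD1[OF M(1), of y] M by auto
    have "b * norm y \<le> exp e" using b(2)[of y] Sy by linarith
    then have "(b * norm y)\<^sup>2 \<le> (exp e)\<^sup>2" using b by (intro power_mono) auto
    then have ny: "(norm y)\<^sup>2 \<le> (exp e)\<^sup>2 / b\<^sup>2" using b by (simp add: field_simps power_mult_distrib)
    let ?p = "S (x + t *\<^sub>R y)" and ?q = "S (x - t *\<^sub>R y)"
    have ty: "t\<^sup>2 * (norm y)\<^sup>2 \<le> t\<^sup>2 * ((exp e)\<^sup>2 / b\<^sup>2)"
      by (intro mult_left_mono ny) simp
    have "(?p + ?q)\<^sup>2 \<le> 2 * (?p\<^sup>2 + ?q\<^sup>2)"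
      using sum_squares_bound[of ?p ?q] by (simp add: power2_eq_square algebra_simps)
    also have "\<dots> \<le> 2 * (2 * (S x)\<^sup>2 + C * (norm (t *\<^sub>R y))\<^sup>2)"
      using S(4)[of x "t *\<^sub>R y"] by simp
    also have "\<dots> \<le> 2 * (2 * (exp e)\<^sup>2 + C * (t\<^sup>2 * ((exp e)\<^sup>2 / b\<^sup>2)))"
      using Sx S(3) is_norm_nonneg[OF S(1)] ty
      by (intro mult_left_mono add_mono power_mono) (auto simp: power_mult_distrib)
    also have "\<dots> = (2 * exp e)\<^sup>2 * (1 + 2 * (D * t\<^sup>2))"
      using b by (simp add: D_def field_simps power2_eq_square)
    also have "\<dots> \<le> (2 * exp e)\<^sup>2 * (1 + D * t\<^sup>2)\<^sup>2"
      using zero_le_power2[of "D * t\<^sup>2"] by (intro mult_left_mono) (auto simp: power2_sum simp del: zero_le_power2)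
    also have "\<dots> = (2 * exp e * (1 + D * t\<^sup>2))\<^sup>2" by (simp add: power_mult_distrib)
    finally have "?p + ?q \<le> 2 * exp e * (1 + D * t\<^sup>2)"
      by (rule power2_le_imp_le) (use D in auto)
    moreover have "M (x + t *\<^sub>R y) \<le> exp e * ?p" "M (x - t *\<^sub>R y) \<le> exp e * ?q"
      using nearD2[OF M(1)] by auto
    then have "M (x + t *\<^sub>R y) + M (x - t *\<^sub>R y) \<le> exp e * (?p + ?q)" by (simp add: distrib_left)
    ultimately have "M (x + t *\<^sub>R y) + M (x - t *\<^sub>R y) \<le> exp e * (2 * exp e * (1 + D * t\<^sup>2))"
      by (meson exp_ge_zero mult_left_mono order_trans)
    also have "\<dots> = exp (2 * e) * (2 + 2 * (D * t\<^sup>2))" unfolding exp_double power2_eq_square by (simp add: algebra_simps)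
    also have "\<dots> \<le> exp (2 * e) * (2 + r * t / 4)" using tD by (intro mult_left_mono) auto
    finally show False using M(4) e(2) by linarith
  qed
  then show "\<exists>L e. is_norm L \<and> near d N L \<and> 0 < e \<and> (\<forall>M. is_norm M \<longrightarrow> near e L M \<longrightarrow>
      \<not> (\<forall>t. 0 < t \<longrightarrow> t < 1 \<longrightarrow> (\<exists>x y. M x = 1 \<and> M y = 1 \<and> r * t \<le> M (x + t *\<^sub>R y) + M (x - t *\<^sub>R y) - 2)))"
    using S(1,2) e(1) t by blast
qed

text \<open>Along a subgradient both one-sided errors are nonnegative, so each is bounded by the symmetric
  second difference, which convexity makes sublinear uniformly on scales below \<open>t\<close>.\<close>

lemma is_norm_differentiable:
  fixes N :: "'a::euclidean_space \<Rightarrow> real"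
  assumes N: "is_norm N" and x: "x \<noteq> 0"
    and smooth: "\<And>r. 0 < r \<Longrightarrow> \<exists>t. 0 < t \<and> t < 1 \<and>
      (\<forall>x y. N x = 1 \<longrightarrow> N y = 1 \<longrightarrow> N (x + t *\<^sub>R y) + N (x - t *\<^sub>R y) - 2 \<le> r * t)"
  shows "N differentiable (at x)"
proof -
  obtain w where w: "w \<bullet> x = N x" "\<And>h. w \<bullet> h \<le> N h" using is_norm_subgradient[OF N] by blast
  obtain B where B: "0 < B" "\<And>x. N x \<le> B * norm x" using is_norm_upper[OF N] by blast
  define a where "a = N x"
  have a: "0 < a" using is_norm_pos[OF N x] by (simp add: a_def)
  have "(N has_derivative (\<lambda>h. w \<bullet> h)) (at x)"
    unfolding has_derivative_at_alt
  proof (intro conjI allI impI bounded_linear_inner_right)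
    fix e :: real assume e: "0 < e"
    then obtain t where t: "0 < t" "t < 1"
      "\<And>x y. N x = 1 \<Longrightarrow> N y = 1 \<Longrightarrow> N (x + t *\<^sub>R y) + N (x - t *\<^sub>R y) - 2 \<le> e / B * t"
      using smooth[of "e / B"] B by fastforce
    have "norm (N y - N x - w \<bullet> (y - x)) \<le> e * norm (y - x)" if y: "norm (y - x) < t * a / B" for y
    proof (cases "y = x")
      case False
      define h where "h = y - x"
      define s where "s = N h"
      have s: "0 < s" using False is_norm_pos[OF N, of h] by (simp add: s_def h_def)
      have "s \<le> B * norm h" using B by (simp add: s_def)
      then have sta: "s \<le> t * a" using y B by (simp add: h_def field_simps)
      \<comment> \<open>The actual step relative to the controlled scale: divided by
        \<open>a\<close>, the point \<open>x + k *\<^sub>R h\<close> sits at parameter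
        \<open>l\<close> on the segment from \<open>?x\<close> to
        \<open>?x + (k * t) *\<^sub>R ?y\<close>.\<close>
      define l where "l = s / (t * a)"
      have l: "0 \<le> l" "l \<le> 1" using s t a sta by (auto simp: l_def)
      let ?x = "(1 / a) *\<^sub>R x" and ?y = "(1 / s) *\<^sub>R h"
      have n1: "N ?x = 1" "N ?y = 1"
        using a s by (simp_all add: is_norm_scaleR[OF N] a_def[symmetric] s_def[symmetric])
      have conv: "N (x + k *\<^sub>R h) \<le> a * ((1 - l) + l * N (?x + (k * t) *\<^sub>R ?y))" for k
      proof -
        have "x + k *\<^sub>R h = a *\<^sub>R ((1 - l) *\<^sub>R ?x + l *\<^sub>R (?x + (k * t) *\<^sub>R ?y))"
          using a s t by (simp add: l_def algebra_simps)
        then have "N (x + k *\<^sub>R h) = a * N ((1 - l) *\<^sub>R ?x + l *\<^sub>R (?x + (k * t) *\<^sub>R ?y))"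
          using a by (simp only: is_norm_scaleR[OF N] abs_of_pos)
        also have "\<dots> \<le> a * (N ((1 - l) *\<^sub>R ?x) + N (l *\<^sub>R (?x + (k * t) *\<^sub>R ?y)))"
          using a by (intro mult_left_mono is_norm_triangle[OF N]) auto
        also have "\<dots> = a * ((1 - l) + l * N (?x + (k * t) *\<^sub>R ?y))"
          using l n1 by (simp only: is_norm_scaleR[OF N, of "1 - l"] is_norm_scaleR[OF N, of l]) auto
        finally show ?thesis .
      qed
      have "N (x + h) + N (x - h) - 2 * a \<le> a * (l * (N (?x + t *\<^sub>R ?y) + N (?x - t *\<^sub>R ?y) - 2))"
        using conv[of 1] conv[of "-1"] by (simp add: algebra_simps)
      also have "\<dots> \<le> a * (l * (e / B * t))"
        using a l t(3)[OF n1] by (intro mult_left_mono) auto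
      also have "\<dots> = s * (e / B)" using a t by (simp add: l_def)
      also have "\<dots> \<le> (B * norm h) * (e / B)" using \<open>s \<le> B * norm h\<close> e B by (intro mult_right_mono) auto
      also have "\<dots> = e * norm h" using B by simp
      finally have "N (x + h) + N (x - h) - 2 * a \<le> e * norm h" .
      moreover have "w \<bullet> (x + h) \<le> N (x + h)" "w \<bullet> (x - h) \<le> N (x - h)" by (rule w(2))+
      moreover have "y = x + h" by (simp add: h_def)
      ultimately show ?thesis using w(1)
        by (simp add: a_def inner_add_right inner_diff_right abs_le_iff)
    qed simp
    moreover have "0 < t * a / B" using t a B by simp
    ultimately show "\<exists>d>0. \<forall>y. norm (y - x) < d \<longrightarrow> norm (N y - N x - w \<bullet> (y - x)) \<le> e * norm (y - x)"
      by blast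
  qed
  then show ?thesis unfolding differentiable_def by blast
qed

section \<open>Norms and unit balls\<close>

text \<open>Gauges get compared through their sublevel sets, which are described only at positive
  levels.\<close>

lemma nonneg_eqI:
  fixes a b :: real
  assumes "0 \<le> a" "0 \<le> b" "\<And>t. 0 < t \<Longrightarrow> a \<le> t \<longleftrightarrow> b \<le> t"
  shows "a = b"
proof (rule antisym)
  show "a \<le> b" "b \<le> a"
    using assms(1,2) assms(3)[of a] assms(3)[of b] field_le_epsilon[of a b] field_le_epsilon[of b a]
    by (metis add.left_neutral assms(3) le_less order_refl)+
qed

lemma unit_ball_absorbing:
  assumes "K \<in> unit_balls"
  obtains t where "0 < t" "(1 / t) *\<^sub>R x \<in> K"
proof -
  from assms obtain e where e: "0 < e" "ball 0 e \<subseteq> K" by (auto simp: unit_balls_def mem_interior)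
  show ?thesis
  proof
    show "0 < norm x / e + 1" using e by (simp add: add_nonneg_pos)
    then show "(1 / (norm x / e + 1)) *\<^sub>R x \<in> K"
      using e by (intro subsetD[OF e(2)]) (simp add: field_simps)
  qed
qed

lemma ball_norm_nonneg:
  assumes "K \<in> unit_balls"
  shows "0 \<le> ball_norm K x"
proof -
  obtain t where "0 < t" "(1 / t) *\<^sub>R x \<in> K" using unit_ball_absorbing[OF assms] .
  then have "x \<in> (\<lambda>y. t *\<^sub>R y) ` K" by (auto intro!: image_eqI[of _ _ "(1 / t) *\<^sub>R x"])
  then show ?thesis using \<open>0 < t\<close> unfolding ball_norm_def by (intro cInf_greatest) auto
qed

text \<open>Convexity and \<open>0 \<in> K\<close> put the scaled point into \<open>K\<close> for
  every \<open>s > t\<close>; closedness then allows \<open>s\<close> to decrease to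
  \<open>t\<close>, so the infimum is attained.\<close>

lemma ball_norm_le_iff:
  assumes K: "K \<in> unit_balls" and t: "0 < t"
  shows "ball_norm K x \<le> t \<longleftrightarrow> (1 / t) *\<^sub>R x \<in> K"
proof -
  define A where "A = {t. 0 < t \<and> x \<in> (\<lambda>y. t *\<^sub>R y) ` K}"
  have A: "s \<in> A \<longleftrightarrow> 0 < s \<and> (1 / s) *\<^sub>R x \<in> K" for s
    unfolding A_def by (auto intro!: image_eqI[of _ _ "(1 / s) *\<^sub>R x"])
  have eq: "ball_norm K x = Inf A" by (simp add: ball_norm_def A_def)
  have bdd: "bdd_below A" unfolding A_def by (rule bdd_belowI[of _ 0]) auto
  have cvx: "convex K" and clo: "closed K" and zero: "0 \<in> K"
    using K interior_subset by (auto simp: unit_balls_def)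
  show ?thesis
  proof
    assume "(1 / t) *\<^sub>R x \<in> K"
    then show "ball_norm K x \<le> t" unfolding eq using t A by (intro cInf_lower bdd) auto
  next
    assume le: "ball_norm K x \<le> t"
    have mem: "(1 / s) *\<^sub>R x \<in> K" if ts: "t < s" for s
    proof -
      have "A \<noteq> {}" using unit_ball_absorbing[OF K, of x] A by blast
      then obtain q where q: "q \<in> A" "q < s"
        using cInf_lessD[of A s] le ts eq by auto
      have "(q / s) *\<^sub>R ((1 / q) *\<^sub>R x) + (1 - q / s) *\<^sub>R 0 \<in> K"
        using q A ts t zero by (intro convexD[OF cvx]) auto
      then show ?thesis using q A by simp
    qed
    have "((\<lambda>s. (1 / s) *\<^sub>R x) \<longlongrightarrow> (1 / t) *\<^sub>R x) (at_right t)"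
      using t by (intro tendsto_intros) auto
    then show "(1 / t) *\<^sub>R x \<in> K"
      by (rule Lim_in_closed_set[OF clo _ trivial_limit_at_right_real, rotated])
        (use mem eventually_at_right_less[of t] in \<open>auto elim: eventually_mono\<close>)
  qed
qed

lemma mem_unit_ball_iff: "K \<in> unit_balls \<Longrightarrow> x \<in> K \<longleftrightarrow> ball_norm K x \<le> 1"
  using ball_norm_le_iff[of K 1 x] by simp

lemma is_norm_ball_norm:
  assumes K: "K \<in> unit_balls"
  shows "is_norm (ball_norm K)"
  unfolding is_norm_def
proof (intro conjI allI impI)
  have cvx: "convex K" and sym: "\<And>x. x \<in> K \<Longrightarrow> - x \<in> K" and zero: "0 \<in> K"
    using K interior_subset by (auto simp: unit_balls_def)
  fix x y :: "real^2" and c :: real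
  show "ball_norm K (x + y) \<le> ball_norm K x + ball_norm K y"
  proof (rule field_le_epsilon)
    fix e :: real assume e: "0 < e"
    define s where "s = ball_norm K x + e / 2"
    define t where "t = ball_norm K y + e / 2"
    have st: "0 < s" "0 < t" using e ball_norm_nonneg[OF K] by (auto simp: s_def t_def add_nonneg_pos)
    have "(1 / s) *\<^sub>R x \<in> K" "(1 / t) *\<^sub>R y \<in> K"
      using st e ball_norm_le_iff[OF K st(1), of x] ball_norm_le_iff[OF K st(2), of y] by (auto simp: s_def t_def)
    then have "(s / (s + t)) *\<^sub>R ((1 / s) *\<^sub>R x) + (t / (s + t)) *\<^sub>R ((1 / t) *\<^sub>R y) \<in> K"
      using st by (intro convexD[OF cvx]) (auto simp: add_divide_distrib[symmetric])
    then have "(1 / (s + t)) *\<^sub>R (x + y) \<in> K" using st by (simp add: scaleR_add_right)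
    then show "ball_norm K (x + y) \<le> ball_norm K x + ball_norm K y + e"
      using ball_norm_le_iff[OF K, of "s + t" "x + y"] st by (simp add: s_def t_def)
  qed
  show "ball_norm K (c *\<^sub>R x) = \<bar>c\<bar> * ball_norm K x"
  proof (rule nonneg_eqI)
    fix t :: real assume t: "0 < t"
    show "ball_norm K (c *\<^sub>R x) \<le> t \<longleftrightarrow> \<bar>c\<bar> * ball_norm K x \<le> t"
    proof (cases "c = 0")
      case False
      have "(1 / t) *\<^sub>R c *\<^sub>R x \<in> K \<longleftrightarrow> (1 / (t / \<bar>c\<bar>)) *\<^sub>R x \<in> K"
        using sym[of "(c / t) *\<^sub>R x"] sym[of "(- c / t) *\<^sub>R x"] by (cases "c \<ge> 0") auto
      then show ?thesis
        using False t ball_norm_le_iff[OF K t, of "c *\<^sub>R x"] ball_norm_le_iff[OF K, of "t / \<bar>c\<bar>" x]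
        by (simp add: field_simps)
    qed (use t zero ball_norm_le_iff[OF K t, of 0] in simp)
  qed (simp_all add: ball_norm_nonneg[OF K])
  assume x: "x \<noteq> 0"
  obtain R where R: "0 < R" "\<And>y. y \<in> K \<Longrightarrow> norm y \<le> R"
    using K by (auto simp: unit_balls_def bounded_pos)
  show "0 < ball_norm K x"
  proof (rule ccontr)
    assume neg: "\<not> 0 < ball_norm K x"
    let ?t = "norm x / (2 * R)"
    have t: "0 < ?t" using x R by simp
    then have "ball_norm K x \<le> ?t" using neg by linarith
    then have "norm ((1 / ?t) *\<^sub>R x) \<le> R" using ball_norm_le_iff[OF K t] R by blast
    then show False using x R by simp
  qed
qed

lemma unit_ball_of_norm:
  assumes N: "is_norm N"
  shows "{x. N x \<le> 1} \<in> unit_balls" "ball_norm {x. N x \<le> 1} = N"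
proof -
  have cont: "continuous_on UNIV N" by (rule is_norm_continuous[OF N])
  obtain b where b: "0 < b" "\<And>x. b * norm x \<le> N x" using is_norm_lower[OF N] by blast
  show *: "{x. N x \<le> 1} \<in> unit_balls"
    unfolding unit_balls_def
  proof (intro CollectI conjI)
    show "closed {x. N x \<le> 1}" by (rule closed_Collect_le[OF cont]) simp
    have "norm x \<le> 1 / b" if "N x \<le> 1" for x
      using b(2)[of x] that b(1) by (simp add: field_simps)
    then show "bounded {x. N x \<le> 1}" unfolding bounded_iff by blast
    show "convex {x. N x \<le> 1}"
    proof (rule convexI)
      fix x y and u v :: real
      assume *: "x \<in> {x. N x \<le> 1}" "y \<in> {x. N x \<le> 1}" "0 \<le> u" "0 \<le> v" "u + v = 1"
      have "N (u *\<^sub>R x + v *\<^sub>R y) \<le> u * N x + v * N y"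
        using is_norm_triangle[OF N, of "u *\<^sub>R x" "v *\<^sub>R y"] * by (simp add: is_norm_scaleR[OF N])
      also have "\<dots> \<le> 1" using * by (intro convex_bound_le) auto
      finally show "u *\<^sub>R x + v *\<^sub>R y \<in> {x. N x \<le> 1}" by simp
    qed
    show "\<forall>x\<in>{x. N x \<le> 1}. - x \<in> {x. N x \<le> 1}" by (simp add: is_norm_minus[OF N])
    have "open {x. N x < 1}" by (rule open_Collect_less[OF cont]) simp
    then show "0 \<in> interior {x. N x \<le> 1}"
      by (rule interiorI) (auto simp: is_norm_zero[OF N])
  qed
  show "ball_norm {x. N x \<le> 1} = N"
  proof (rule ext, rule nonneg_eqI)
    show "ball_norm {x. N x \<le> 1} x \<le> t \<longleftrightarrow> N x \<le> t" if "0 < t" for x t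
      using ball_norm_le_iff[OF * that, of x] that by (simp add: is_norm_scaleR[OF N])
  qed (simp_all add: ball_norm_nonneg[OF *] is_norm_nonneg[OF N])
qed

section \<open>Hausdorff distance of unit balls against the ratio of norms\<close>

text \<open>The suprema are taken over real numbers and bound their terms only if the images are
  bounded, which boundedness of the sets provides.\<close>

lemma infdist_le_hausdorff_dist:
  assumes "bounded A" "bounded B" "A \<noteq> {}" "B \<noteq> {}"
  shows "a \<in> A \<Longrightarrow> infdist a B \<le> hausdorff_dist A B" "b \<in> B \<Longrightarrow> infdist b A \<le> hausdorff_dist A B"
proof -
  have bdd: "bdd_above ((\<lambda>a. infdist a D) ` C)"
    if CD: "bounded C" "D \<noteq> {}" for C D :: "(real^2) set"
  proof -
    obtain d where "d \<in> D" using CD by blast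
    obtain R where "\<And>c. c \<in> C \<Longrightarrow> dist d c \<le> R" using CD bounded_any_center[of C d] by auto
    then show ?thesis using infdist_le[OF \<open>d \<in> D\<close>]
      by (intro bdd_aboveI2[of _ _ R]) (metis dist_commute order_trans)
  qed
  show "a \<in> A \<Longrightarrow> infdist a B \<le> hausdorff_dist A B"
    unfolding hausdorff_dist_def by (intro max.coboundedI1 cSUP_upper bdd assms)
  show "b \<in> B \<Longrightarrow> infdist b A \<le> hausdorff_dist A B"
    unfolding hausdorff_dist_def by (intro max.coboundedI2 cSUP_upper bdd assms)
qed

lemma hausdorff_dist_less:
  assumes "bounded A" "bounded B" "A \<noteq> {}" "B \<noteq> {}" "hausdorff_dist A B < e"
  shows "a \<in> A \<Longrightarrow> \<exists>b\<in>B. dist a b < e" "b \<in> B \<Longrightarrow> \<exists>a\<in>A. dist b a < e"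
proof -
  have *: "\<exists>d\<in>D. dist c d < e" if "infdist c D < e" "D \<noteq> {}" for c and D :: "(real^2) set"
    using that cInf_lessD[of "(\<lambda>d. dist c d) ` D" e] by (auto simp: infdist_def)
  show "a \<in> A \<Longrightarrow> \<exists>b\<in>B. dist a b < e" "b \<in> B \<Longrightarrow> \<exists>a\<in>A. dist b a < e"
    using infdist_le_hausdorff_dist[OF assms(1-4)] assms * by (meson le_less_trans)+
qed

lemma hausdorff_dist_le:
  assumes "A \<noteq> {}" "B \<noteq> {}" "\<And>a. a \<in> A \<Longrightarrow> \<exists>b\<in>B. dist a b \<le> e" "\<And>b. b \<in> B \<Longrightarrow> \<exists>a\<in>A. dist b a \<le> e"
  shows "hausdorff_dist A B \<le> e"
  unfolding hausdorff_dist_def using assms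
  by (intro max.boundedI cSUP_least) (blast intro: infdist_le2)+

lemma unit_ball_nonempty: "K \<in> unit_balls \<Longrightarrow> K \<noteq> {}"
  using interior_subset by (auto simp: unit_balls_def)

lemma is_norm_le_scaled:
  fixes N M :: "'a::real_vector \<Rightarrow> real"
  assumes N: "is_norm N" and M: "is_norm M" and le: "\<And>x. N x \<le> 1 \<Longrightarrow> M x \<le> c"
  shows "M x \<le> c * N x"
proof (cases "x = 0")
  case False
  then have Nx: "0 < N x" by (rule is_norm_pos[OF N])
  then have "M ((1 / N x) *\<^sub>R x) \<le> c" by (intro le) (simp add: is_norm_scaleR[OF N])
  then show ?thesis using Nx by (simp add: is_norm_scaleR[OF M] field_simps)
qed (simp add: is_norm_zero[OF N] is_norm_zero[OF M])

text \<open>If \<open>cball 0 \<rho> \<subseteq> M + cball 0 e\<close> with \<open>M\<close> closed and convex, the summand cancels; the cancellation law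
  is read off the support functions.\<close>

lemma cball_subset_of_sum:
  fixes M :: "'a::euclidean_space set" and e \<rho> :: real
  assumes M: "closed M" "convex M" "M \<noteq> {}" and e: "0 \<le> \<rho>"
    and sub: "\<And>x. norm x \<le> \<rho> \<Longrightarrow> \<exists>m\<in>M. dist x m \<le> e"
  shows "cball 0 (\<rho> - e) \<subseteq> M"
proof
  fix x :: 'a assume x: "x \<in> cball 0 (\<rho> - e)"
  show "x \<in> M"
  proof (rule ccontr)
    assume "x \<notin> M"
    then obtain a b where ab: "a \<bullet> x < b" "\<forall>y\<in>M. b < a \<bullet> y"
      using separating_hyperplane_closed_point[OF M(2,1)] by blast
    have a: "a \<noteq> 0" using ab M(3) by force
    \<comment> \<open>The point of the ball of radius \<open>\<rho>\<close> where \<open>a\<close>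
      is smallest: a member of \<open>M\<close> within \<open>e\<close> of it has an inner product
      with \<open>a\<close> no larger than that of \<open>x\<close>, against the separation.\<close>
    define z where "z = (- \<rho> / norm a) *\<^sub>R a"
    have "norm z \<le> \<rho>" using a e by (simp add: z_def)
    then obtain m where m: "m \<in> M" "dist z m \<le> e" using sub by blast
    have "a \<bullet> m = a \<bullet> z + a \<bullet> (m - z)" by (simp add: inner_diff_right)
    also have "\<dots> \<le> - \<rho> * norm a + norm a * e"
    proof (rule add_mono)
      show "a \<bullet> z \<le> - \<rho> * norm a" using a by (simp add: z_def power2_norm_eq_inner[symmetric] power2_eq_square)
      have "a \<bullet> (m - z) \<le> norm a * norm (m - z)" by (rule norm_cauchy_schwarz)
      also have "\<dots> \<le> norm a * e" using m by (intro mult_left_mono) (auto simp: dist_norm norm_minus_commute)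
      finally show "a \<bullet> (m - z) \<le> norm a * e" .
    qed
    also have "\<dots> = - (norm a * (\<rho> - e))" by (simp add: algebra_simps)
    also have "\<dots> \<le> - (norm a * norm x)" using x by (simp add: mult_left_mono)
    also have "\<dots> \<le> a \<bullet> x" using Cauchy_Schwarz_ineq2[of a x] by linarith
    finally show False using ab m by force
  qed
qed

text \<open>A point within \<open>e\<close> of a unit ball that contains \<open>cball 0 r\<close>
  has gauge at most \<open>1 + e / r\<close>. For \<open>K\<close> an inner radius is at hand; for
  \<open>M\<close> one that does not depend on \<open>M\<close> comes from cancelling the
  \<open>e\<close>-neighbourhood.\<close>

lemma near_of_hausdorff_dist:
  assumes K: "K \<in> unit_balls" and d: "0 < d"
  obtains e where "0 < e"
    "\<And>M. M \<in> unit_balls \<Longrightarrow> hausdorff_dist K M < e \<Longrightarrow> near d (ball_norm K) (ball_norm M)"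
proof -
  obtain \<rho> where \<rho>: "0 < \<rho>" "cball 0 \<rho> \<subseteq> K" using K by (auto simp: unit_balls_def mem_interior_cball)
  \<comment> \<open>Leaves \<open>M\<close> the inner radius \<open>\<rho> * exp (- d)\<close>, for
    which \<open>1 + e / r\<close> is exactly \<open>exp d\<close>. For \<open>K\<close> it is 2 -
    \<open>exp (- d)\<close>, at most \<open>exp d\<close> because \<open>cosh d\<close> is at least
    1.\<close>
  define e where "e = \<rho> * (1 - exp (- d))"
  have "near d (ball_norm K) (ball_norm M)" if M: "M \<in> unit_balls" and h: "hausdorff_dist K M < e" for M
  proof -
    let ?N = "ball_norm K" and ?M = "ball_norm M"
    have N: "is_norm ?N" and N': "is_norm ?M" using K M is_norm_ball_norm by auto
    have dist: "\<And>x. x \<in> K \<Longrightarrow> \<exists>y\<in>M. dist x y < e" "\<And>x. x \<in> M \<Longrightarrow> \<exists>y\<in>K. dist x y < e"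
      using hausdorff_dist_less[OF _ _ unit_ball_nonempty[OF K] unit_ball_nonempty[OF M] h] K M
      by (auto simp: unit_balls_def)
    have "cball 0 (\<rho> - e) \<subseteq> M"
    proof (rule cball_subset_of_sum)
      show "\<exists>m\<in>M. dist x m \<le> e" if "norm x \<le> \<rho>" for x
        using dist(1)[of x] that \<rho> by (force simp: subset_iff)
    qed (use M \<rho> unit_ball_nonempty in \<open>auto simp: unit_balls_def\<close>)
    then have subM: "cball 0 (\<rho> * exp (- d)) \<subseteq> M" by (simp add: e_def algebra_simps)
    have small: "ball_norm L y \<le> e / r" if L: "L \<in> unit_balls" "cball 0 r \<subseteq> L" "0 < r" "norm y \<le> e" for L r y
    proof -
      have "ball_norm L y \<le> 1 / r * norm y"
      proof (rule is_norm_le_scaled[where N = norm and x = y])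
        show "is_norm (norm :: real^2 \<Rightarrow> real)" by (simp add: is_norm_def norm_triangle_ineq)
        show "is_norm (ball_norm L)" by (rule is_norm_ball_norm[OF L(1)])
        fix z :: "real^2" assume "norm z \<le> 1"
        then have "r *\<^sub>R z \<in> L" using L(2,3) by (intro subsetD[OF L(2)]) (simp add: mult_left_le)
        then show "ball_norm L z \<le> 1 / r"
          using L(3) ball_norm_le_iff[OF L(1), of "1 / r" z] by simp
      qed
      also have "\<dots> \<le> e / r" using L by (simp add: divide_right_mono)
      finally show ?thesis .
    qed
    have split: "ball_norm L x \<le> 1 + e / r"
      if "L \<in> unit_balls" "cball 0 r \<subseteq> L" "0 < r" "y \<in> L" "dist x y < e" for L r x y
    proof -
      have "ball_norm L x \<le> ball_norm L y + ball_norm L (x - y)"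
        using is_norm_triangle[OF is_norm_ball_norm[OF that(1)], of y "x - y"] by simp
      moreover have "ball_norm L y \<le> 1" using mem_unit_ball_iff that by blast
      moreover have "ball_norm L (x - y) \<le> e / r" using small that by (simp add: dist_norm)
      ultimately show ?thesis by linarith
    qed
    have e1: "1 + e / \<rho> \<le> exp d"
      using \<rho> cosh_real_ge_1[of d] by (simp add: e_def cosh_field_def)
    have e2: "1 + e / (\<rho> * exp (- d)) = exp d"
      using \<rho> by (simp add: e_def exp_minus field_simps)
    show ?thesis
    proof (rule nearI)
      fix x
      show "?N x \<le> exp d * ?M x"
      proof (rule is_norm_le_scaled[OF N' N])
        fix x assume "?M x \<le> 1"
        then obtain y where "y \<in> K" "dist x y < e" using mem_unit_ball_iff[OF M] dist(2) by blast
        then show "?N x \<le> exp d" using split[OF K \<rho>(2,1)] e1 by fastforce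
      qed
      show "?M x \<le> exp d * ?N x"
      proof (rule is_norm_le_scaled[OF N N'])
        fix x assume "?N x \<le> 1"
        then obtain y where "y \<in> M" "dist x y < e" using mem_unit_ball_iff[OF K] dist(1) by blast
        then show "?M x \<le> exp d" using split[OF M subM] e2 \<rho> by fastforce
      qed
    qed
  qed
  moreover have "0 < e" using \<rho> d by (simp add: e_def)
  ultimately show ?thesis using that by blast
qed

text \<open>Contracting by \<open>exp (- d)\<close> moves points of either ball into the other, over
  a short distance since \<open>K\<close> is bounded. For points of \<open>M\<close> the bound
  applies only after the contraction, whence the factor \<open>exp d - 1\<close>.\<close>

lemma hausdorff_dist_of_near:
  assumes K: "K \<in> unit_balls" and e: "0 < e"
  obtains d where "0 < d"
    "\<And>M. M \<in> unit_balls \<Longrightarrow> near d (ball_norm K) (ball_norm M) \<Longrightarrow> hausdorff_dist K M < e"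
proof -
  obtain R where R: "0 < R" "\<And>y. y \<in> K \<Longrightarrow> norm y \<le> R"
    using K by (auto simp: unit_balls_def bounded_pos)
  define d where "d = ln (1 + e / (2 * R))"
  have d: "0 < d" unfolding d_def using e R by (intro ln_gt_zero) simp
  have "exp d = 1 + e / (2 * R)" using e R by (simp add: d_def add_pos_pos)
  then have Rd: "R * (exp d - 1) = e / 2" using R by simp
  have scaled: "exp (- d) *\<^sub>R x \<in> B" if "B \<in> unit_balls" "ball_norm B x \<le> exp d" for B x
    using ball_norm_le_iff[OF that(1), of "exp d" x] that(2) by (simp add: exp_minus divide_inverse)
  have dist: "dist x (exp (- d) *\<^sub>R x) = (1 - exp (- d)) * norm x" for x :: "real^2"
  proof -
    have "x - exp (- d) *\<^sub>R x = (1 - exp (- d)) *\<^sub>R x" by (simp add: algebra_simps)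
    then show ?thesis using d by (simp add: dist_norm)
  qed
  have "hausdorff_dist K M < e" if M: "M \<in> unit_balls" and n: "near d (ball_norm K) (ball_norm M)" for M
  proof -
    have "hausdorff_dist K M \<le> e / 2"
    proof (rule hausdorff_dist_le)
      fix x assume x: "x \<in> K"
      have "ball_norm M x \<le> exp d * ball_norm K x" by (rule nearD2[OF n])
      also have "\<dots> \<le> exp d" using x mem_unit_ball_iff[OF K] by simp
      finally have "exp (- d) *\<^sub>R x \<in> M" by (rule scaled[OF M])
      moreover have "dist x (exp (- d) *\<^sub>R x) \<le> e / 2"
      proof -
        have "(1 - exp (- d)) * norm x \<le> (exp d - 1) * R"
          using d R x cosh_real_ge_1[of d] by (intro mult_mono) (auto simp: cosh_field_def)
        then show ?thesis using Rd by (simp add: dist mult.commute)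
      qed
      ultimately show "\<exists>b\<in>M. dist x b \<le> e / 2" by blast
    next
      fix x assume x: "x \<in> M"
      have "ball_norm K x \<le> exp d * ball_norm M x" by (rule nearD1[OF n])
      also have "\<dots> \<le> exp d" using x mem_unit_ball_iff[OF M] by simp
      finally have mem: "exp (- d) *\<^sub>R x \<in> K" by (rule scaled[OF K])
      moreover have "dist x (exp (- d) *\<^sub>R x) \<le> e / 2"
      proof -
        have "(1 - exp (- d)) * norm x = (exp d - 1) * norm (exp (- d) *\<^sub>R x)"
          by (simp add: exp_minus field_simps)
        also have "\<dots> \<le> (exp d - 1) * R" using d R(2)[OF mem] by (intro mult_left_mono) auto
        finally show ?thesis using Rd by (simp add: dist mult.commute)
      qed
      ultimately show "\<exists>a\<in>K. dist x a \<le> e / 2" by blast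
    qed (use K M unit_ball_nonempty in auto)
    then show ?thesis using e by simp
  qed
  then show ?thesis using that d by blast
qed

lemma ub_nowhere_dense_avoidable:
  assumes T: "avoidable T"
  shows "ub_nowhere_dense {K \<in> unit_balls. T (ball_norm K)}"
  unfolding ub_nowhere_dense_def
proof (intro allI impI)
  fix U assume U: "ub_open U \<and> U \<noteq> {}"
  then obtain K where K: "K \<in> U" "K \<in> unit_balls" by (auto simp: ub_open_def)
  have bn: "is_norm (ball_norm M)" if "M \<in> unit_balls" for M using is_norm_ball_norm that .
  have near_U: "\<exists>d>0. \<forall>M\<in>unit_balls. near d (ball_norm K) (ball_norm M) \<longrightarrow> M \<in> U" if "K \<in> U" for K
    using that U unfolding ub_open_def by (metis hausdorff_dist_of_near subsetD)
  obtain d where d: "0 < d" "\<And>M. M \<in> unit_balls \<Longrightarrow> near d (ball_norm K) (ball_norm M) \<Longrightarrow> M \<in> U"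
    using near_U[OF K(1)] by blast
  obtain L e where L: "is_norm L" "near (d / 2) (ball_norm K) L" "0 < e"
    "\<And>M. is_norm M \<Longrightarrow> near e L M \<Longrightarrow> \<not> T M"
    using T[unfolded avoidable_def, rule_format, of "ball_norm K" "d / 2"] d(1) bn[OF K(2)] by auto
  \<comment> \<open>The interior, in the sense of \<open>near\<close>, of \<open>U\<close> without
    the norms satisfying \<open>T\<close>.\<close>
  define V where "V = {M \<in> unit_balls. \<exists>r>0. \<forall>M'\<in>unit_balls.
    near r (ball_norm M) (ball_norm M') \<longrightarrow> M' \<in> U \<and> \<not> T (ball_norm M')}"
  have "ub_open V"
    unfolding ub_open_def
  proof (intro conjI ballI)
    fix A assume "A \<in> V"
    then obtain r where A: "A \<in> unit_balls" and r: "0 < r"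
      "\<And>M'. M' \<in> unit_balls \<Longrightarrow> near r (ball_norm A) (ball_norm M') \<Longrightarrow> M' \<in> U \<and> \<not> T (ball_norm M')"
      by (auto simp: V_def)
    obtain \<epsilon> where \<epsilon>: "0 < \<epsilon>"
      "\<And>M. M \<in> unit_balls \<Longrightarrow> hausdorff_dist A M < \<epsilon> \<Longrightarrow> near (r / 2) (ball_norm A) (ball_norm M)"
      using near_of_hausdorff_dist[OF A, of "r / 2"] r(1) by auto
    have "M \<in> V" if M: "M \<in> unit_balls" "hausdorff_dist A M < \<epsilon>" for M
    proof -
      have "M' \<in> U \<and> \<not> T (ball_norm M')"
        if "M' \<in> unit_balls" "near (r / 2) (ball_norm M) (ball_norm M')" for M'
        using r(2)[OF that(1)] near_trans[OF \<epsilon>(2)[OF M] that(2)] by simp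
      then show ?thesis using M(1) r(1) by (auto simp: V_def intro!: exI[of _ "r / 2"])
    qed
    then show "\<exists>e>0. \<forall>L\<in>unit_balls. hausdorff_dist A L < e \<longrightarrow> L \<in> V" using \<epsilon>(1) by blast
  qed (auto simp: V_def)
  moreover have "{x. L x \<le> 1} \<in> V"
  proof -
    have "M \<in> U \<and> \<not> T (ball_norm M)"
      if M: "M \<in> unit_balls" "near (min e (d / 2)) L (ball_norm M)" for M
    proof -
      have "near (d / 2) L (ball_norm M)" "near e L (ball_norm M)"
        using M(2) L(1) bn[OF M(1)] by (auto intro: near_mono)
      then show ?thesis using d(2)[OF M(1)] near_trans[OF L(2)] L(4) bn[OF M(1)] by fastforce
    qed
    moreover have "0 < min e (d / 2)" using L(3) d(1) by simp
    ultimately show ?thesis unfolding V_def using unit_ball_of_norm[OF L(1)]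
      by (intro CollectI conjI exI[of _ "min e (d / 2)"]) auto
  qed
  moreover have "A \<in> U \<and> \<not> T (ball_norm A)" if AV: "A \<in> V" for A
  proof -
    obtain r where A: "A \<in> unit_balls" and r: "0 < r" and
      "\<forall>M'\<in>unit_balls. near r (ball_norm A) (ball_norm M') \<longrightarrow> M' \<in> U \<and> \<not> T (ball_norm M')"
      using AV by (auto simp: V_def)
    then show ?thesis using near_mono[OF near_refl bn[OF A] bn[OF A] less_imp_le[OF r]] A by blast
  qed
  ultimately show "\<exists>V. ub_open V \<and> V \<noteq> {} \<and> V \<subseteq> U \<and> V \<inter> {K \<in> unit_balls. T (ball_norm K)} = {}"
    by (intro exI[of _ V]) auto
qed

section \<open>Rational dependencies among unit vectors\<close>

text \<open>Gaussian elimination, one equation at a time: a pivot unknown is solved for and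
  substituted into the remaining equations.\<close>

lemma underdetermined_system:
  fixes M :: "'e \<Rightarrow> 's \<Rightarrow> 'f::field"
  assumes "finite E" "finite S" "card E < card S"
  shows "\<exists>c. (\<exists>s\<in>S. c s \<noteq> 0) \<and> (\<forall>e\<in>E. (\<Sum>s\<in>S. M e s * c s) = 0)"
  using assms
proof (induction E arbitrary: S M rule: finite_induct)
  case empty
  then have "S \<noteq> {}" by auto
  then show ?case by (intro exI[of _ "\<lambda>_. 1"]) auto
next
  case (insert e E)
  show ?case
  proof (cases "\<forall>s\<in>S. M e s = 0")
    case True
    then show ?thesis using insert.IH[of S M] insert.prems insert.hyps by auto
  next
    case False
    then obtain p where p: "p \<in> S" "M e p \<noteq> 0" by blast
    define M' where "M' = (\<lambda>e' s. M e' s - M e' p * M e s / M e p)"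
    have "card E < card (S - {p})" using p insert.prems insert.hyps by simp
    then obtain c' where c': "\<exists>s\<in>S - {p}. c' s \<noteq> 0"
      "\<And>e'. e' \<in> E \<Longrightarrow> (\<Sum>s\<in>S - {p}. M' e' s * c' s) = 0"
      using insert.IH[of "S - {p}" M'] insert.prems by auto
    define k where "k = - (\<Sum>s\<in>S - {p}. M e s * c' s) / M e p"
    define c where "c = c'(p := k)"
    have sum: "(\<Sum>s\<in>S. M e' s * c s) = M e' p * k + (\<Sum>s\<in>S - {p}. M e' s * c' s)" for e'
      using p(1) insert.prems(1) by (simp add: sum.remove[of S p] c_def)
    have "(\<Sum>s\<in>S. M e s * c s) = 0" unfolding sum using p(2) by (simp add: k_def)
    moreover have "(\<Sum>s\<in>S. M e' s * c s) = 0" if "e' \<in> E" for e'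
    proof -
      have "(\<Sum>s\<in>S - {p}. M' e' s * c' s)
          = (\<Sum>s\<in>S - {p}. M e' s * c' s) - (M e' p / M e p) * (\<Sum>s\<in>S - {p}. M e s * c' s)"
        by (simp add: M'_def left_diff_distrib sum_subtractf sum_distrib_left mult.assoc)
      then show ?thesis unfolding sum using c'(2)[OF that] by (simp add: k_def)
    qed
    moreover have "\<exists>s\<in>S. c s \<noteq> 0" using c'(1) by (auto simp: c_def)
    ultimately show ?thesis by blast
  qed
qed

text \<open>A subgradient at \<open>z\<close> computes \<open>P\<close> up to the factor
  \<open>exp d\<close> on a neighbourhood of \<open>z\<close>, and by compactness finitely many such
  neighbourhoods cover the sphere.\<close>

lemma near_finitely_many_functionals:
  fixes P :: "'a::euclidean_space \<Rightarrow> real"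
  assumes P: "is_norm P" and d: "0 < d"
  obtains W where "finite W" "\<And>w x. w \<in> W \<Longrightarrow> w \<bullet> x \<le> P x" "\<And>x. \<exists>w\<in>W. P x \<le> exp d * (w \<bullet> x)"
proof -
  have "\<exists>w. w \<bullet> z = P z \<and> (\<forall>h. w \<bullet> h \<le> P h)" for z using is_norm_subgradient[OF P] by metis
  then obtain w where w: "\<And>z. w z \<bullet> z = P z" "\<And>z h. w z \<bullet> h \<le> P h" by metis
  define G where "G = (\<lambda>z. {x. P x < exp d * (w z \<bullet> x)})"
  have "open (G z)" for z
    unfolding G_def by (intro open_Collect_less is_norm_continuous[OF P] continuous_intros)
  moreover have "sphere 0 1 \<subseteq> (\<Union>z\<in>sphere 0 1. G z)"
  proof
    fix z :: 'a assume z: "z \<in> sphere 0 1"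
    then have "0 < P z" by (intro is_norm_pos[OF P]) auto
    then have "z \<in> G z" using d by (simp add: G_def w)
    then show "z \<in> (\<Union>z\<in>sphere 0 1. G z)" using z by blast
  qed
  ultimately obtain Z where Z: "finite Z" "sphere 0 1 \<subseteq> (\<Union>z\<in>Z. G z)"
    using compactE_image[OF compact_sphere, of "sphere 0 1" G] by metis
  show ?thesis
  proof
    show "finite (w ` Z)" using Z by simp
    show "u \<bullet> x \<le> P x" if "u \<in> w ` Z" for u x using that w by auto
    fix x :: 'a
    obtain b :: 'a where b: "b \<in> sphere 0 1" using SOME_Basis norm_Basis by (metis mem_sphere_0)
    show "\<exists>u\<in>w ` Z. P x \<le> exp d * (u \<bullet> x)"
    proof (cases "x = 0")
      case True
      then show ?thesis using Z(2) b by (auto simp: is_norm_zero[OF P])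
    next
      case False
      then have "(1 / norm x) *\<^sub>R x \<in> sphere 0 1" by simp
      then obtain z where z: "z \<in> Z" "(1 / norm x) *\<^sub>R x \<in> G z" using Z(2) by blast
      then have "P x < exp d * (w z \<bullet> x)"
        using False by (simp add: G_def is_norm_scaleR[OF P] field_simps)
      then show ?thesis using z(1) by (intro bexI[of _ "w z"]) auto
    qed
  qed
qed

text \<open>Each sum is a polynomial in \<open>t\<close>. Injectivity of \<open>j f\<close> isolates
  one nonzero coefficient, and \<open>Suc\<close> keeps its exponent apart from the constant terms;
  so finitely many \<open>f\<close> exclude only finitely many \<open>t\<close>.\<close>

lemma exists_perturbation_avoiding:
  fixes c :: "'f \<Rightarrow> nat \<Rightarrow> real" and j :: "'f \<Rightarrow> nat \<Rightarrow> nat" and b :: real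
  assumes "finite F" "0 < b" and nz: "\<And>f. f \<in> F \<Longrightarrow> \<exists>s<k. c f s \<noteq> 0"
    and inj: "\<And>f. f \<in> F \<Longrightarrow> inj_on (j f) {..<k}"
  obtains t where "0 < t" "t < b" "\<And>f. f \<in> F \<Longrightarrow> (\<Sum>s<k. c f s * (1 + t ^ Suc (j f s))) \<noteq> 0"
proof -
  define p where "p = (\<lambda>f. \<Sum>s<k. monom (c f s) 0 + monom (c f s) (Suc (j f s)))"
  have poly: "poly (p f) t = (\<Sum>s<k. c f s * (1 + t ^ Suc (j f s)))" for f t
    by (simp add: p_def poly_sum poly_monom algebra_simps)
  have "p f \<noteq> 0" if f: "f \<in> F" for f
  proof -
    obtain s where s: "s < k" "c f s \<noteq> 0" using nz[OF f] by blast
    have "coeff (p f) (Suc (j f s)) = (\<Sum>r<k. if r = s then c f r else 0)"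
      unfolding p_def coeff_sum using inj_onD[OF inj[OF f]] s(1) by (intro sum.cong) auto
    also have "\<dots> = c f s" using s(1) by simp
    finally show ?thesis using s(2) by force
  qed
  then have "finite (\<Union>f\<in>F. {t. poly (p f) t = 0})" using assms(1) poly_roots_finite by blast
  then have "infinite ({0<..<b} - (\<Union>f\<in>F. {t. poly (p f) t = 0}))"
    using assms(2) infinite_Ioo by (intro Diff_infinite_finite) auto
  then obtain t where "t \<in> {0<..<b} - (\<Union>f\<in>F. {t. poly (p f) t = 0})"
    using infinite_imp_nonempty by blast
  then show ?thesis using that[of t] poly by auto
qed

lemma is_norm_Max_functionals:
  fixes w :: "'j \<Rightarrow> 'a::real_inner"
  assumes J: "finite J" "J \<noteq> {}" and pos: "\<And>x. x \<noteq> 0 \<Longrightarrow> \<exists>j\<in>J. w j \<bullet> x \<noteq> 0"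
  shows "is_norm (\<lambda>x. MAX j\<in>J. \<bar>w j \<bullet> x\<bar>)"
  unfolding is_norm_def
proof (intro conjI allI impI)
  let ?L = "\<lambda>x. MAX j\<in>J. \<bar>w j \<bullet> x\<bar>"
  have ge: "\<bar>w j \<bullet> x\<bar> \<le> ?L x" if "j \<in> J" for j x using that J by simp
  fix x y :: 'a and c :: real
  show "?L (x + y) \<le> ?L x + ?L y"
  proof (rule Max.boundedI)
    fix l assume "l \<in> (\<lambda>j. \<bar>w j \<bullet> (x + y)\<bar>) ` J"
    then obtain j where j: "j \<in> J" "l = \<bar>w j \<bullet> x + w j \<bullet> y\<bar>" by (auto simp: inner_add_right)
    then show "l \<le> ?L x + ?L y" using ge[OF j(1), of x] ge[OF j(1), of y] by linarith
  qed (use J in auto)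
  have "mono (\<lambda>l. \<bar>c\<bar> * l)" by (simp add: mono_def mult_left_mono)
  then have "\<bar>c\<bar> * ?L x = Max ((\<lambda>l. \<bar>c\<bar> * l) ` (\<lambda>j. \<bar>w j \<bullet> x\<bar>) ` J)"
    using J by (intro mono_Max_commute) auto
  then show "?L (c *\<^sub>R x) = \<bar>c\<bar> * ?L x" by (simp add: image_image abs_mult)
  assume "x \<noteq> 0"
  then obtain j where "j \<in> J" "w j \<bullet> x \<noteq> 0" using pos by blast
  then show "0 < ?L x" using ge[of j x] by linarith
qed

text \<open>Replace the norm by a uniformly convex one and that one by a polyhedral norm all of whose faces are shorter
  than \<open>r\<close>. Vectors that are \<open>r\<close>-separated up to sign then lie on different faces, so prescribing that
  they have norm 1 amounts to more linear equations than there are unknowns, and shifting the faces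
  generically makes the system inconsistent.\<close>

lemma avoidable_dependent:
  fixes A :: "nat \<Rightarrow> nat \<Rightarrow> real" and r :: real
  assumes k: "m * DIM('a) < k" and r: "0 < r"
  shows "avoidable (\<lambda>N :: 'a::euclidean_space \<Rightarrow> real. \<exists>u x.
    (\<forall>s<k. x s = (\<Sum>i<m. A s i *\<^sub>R u i) \<and> N (x s) = 1) \<and>
    (\<forall>s<k. \<forall>t<k. s \<noteq> t \<longrightarrow> r \<le> norm (x s - x t) \<and> r \<le> norm (x s + x t)))"
  unfolding avoidable_def
proof (intro allI impI)
  fix N :: "'a \<Rightarrow> real" and d :: real
  assume "is_norm N" and d: "0 < d"
  then obtain P c0 where P: "is_norm P" "near (d / 2) N P" "0 < c0"
    "\<And>x y. c0 * (norm (x - y))\<^sup>2 \<le> ((P x)\<^sup>2 + (P y)\<^sup>2) / 2 - (P ((1/2) *\<^sub>R (x + y)))\<^sup>2"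
    using near_uniformly_convex[of N "d / 2"] by auto
  \<comment> \<open>The 6 arises from \<open>P (x s) \<le> exp (3 * e)\<close> by squaring;
    \<open>d / 4\<close> leaves room for the \<open>2 * e\<close> between \<open>P\<close> and
    \<open>L\<close>.\<close>
  obtain e where e: "0 < e" "e < d / 4" "exp (6 * e) - exp (- (6 * e)) < c0 * r\<^sup>2"
    using exp_diff_small[of "d / 4" "c0 * r\<^sup>2" 6] P(3) r d by auto
  obtain W where W: "finite W" "\<And>w x. w \<in> W \<Longrightarrow> w \<bullet> x \<le> P x" "\<And>x. \<exists>w\<in>W. P x \<le> exp e * (w \<bullet> x)"
    using near_finitely_many_functionals[OF P(1) e(1)] by blast
  obtain q and w :: "nat \<Rightarrow> 'a" where w: "W = w ` {..<q}"
    using finite_imp_nat_seg_image_inj_on[OF W(1)] by (metis lessThan_def)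
  have w_abs: "\<bar>w j \<bullet> x\<bar> \<le> P x" if "j < q" for j x
    using W(2)[of "w j" x] W(2)[of "w j" "- x"] that w by (auto simp: is_norm_minus[OF P(1)] abs_le_iff)
  \<comment> \<open>All assignments of a functional and a sign to each of the \<open>k\<close>
    vectors, using no functional twice. As there are finitely many, one \<open>t\<close> and one
    radius serve them all.\<close>
  define F where "F = {f \<in> {..<k} \<rightarrow>\<^sub>E {..<q} \<times> {-1, 1::real}. inj_on (\<lambda>s. fst (f s)) {..<k}}"
  have finF: "finite F"
    unfolding F_def by (rule finite_subset[OF _ finite_PiE[of "{..<k}" "\<lambda>_. {..<q} \<times> {-1, 1::real}"]]) auto
  \<comment> \<open>For each assignment there is a nonzero relation between the signed functionals,
    viewed as functions of \<open>u\<close>. It has one equation per coordinate of each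
    \<open>u i\<close>, fewer than its \<open>k\<close> coefficients.\<close>
  have "\<exists>c. (\<exists>s\<in>{..<k}. c s \<noteq> 0) \<and> (\<forall>ib\<in>{..<m} \<times> Basis.
      (\<Sum>s<k. (A s (fst ib) * (snd (f s) * (w (fst (f s)) \<bullet> snd ib))) * c s) = 0)" for f
    by (rule underdetermined_system) (use k in \<open>auto simp: card_cartesian_product\<close>)
  then have "\<forall>f. \<exists>c. (\<exists>s\<in>{..<k}. c s \<noteq> 0) \<and> (\<forall>ib\<in>{..<m} \<times> Basis.
      (\<Sum>s<k. (A s (fst ib) * (snd (f s) * (w (fst (f s)) \<bullet> snd ib))) * c s) = 0)" by blast
  from choice[OF this] obtain c where c: "\<And>f. (\<exists>s\<in>{..<k}. c f s \<noteq> 0) \<and> (\<forall>ib\<in>{..<m} \<times> Basis.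
      (\<Sum>s<k. (A s (fst ib) * (snd (f s) * (w (fst (f s)) \<bullet> snd ib))) * c f s) = 0)" by blast
  have c_nz: "\<exists>s<k. c f s \<noteq> 0" for f using c[of f] by blast
  have c_eq: "(\<Sum>s<k. (A s i * (snd (f s) * (w (fst (f s)) \<bullet> b))) * c f s) = 0"
    if "i < m" "b \<in> Basis" for f i b
    using c[of f] that by force
  have c_vec: "(\<Sum>s<k. (A s i * snd (f s) * c f s) *\<^sub>R w (fst (f s))) = 0" if "i < m" for f i
  proof (rule euclidean_eqI)
    fix b :: 'a assume "b \<in> Basis"
    then show "(\<Sum>s<k. (A s i * snd (f s) * c f s) *\<^sub>R w (fst (f s))) \<bullet> b = 0 \<bullet> b"
      using c_eq[OF that, of b f] by (simp add: inner_sum_left mult_ac)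
  qed
  obtain t where t: "0 < t" "t < min 1 e"
    "\<And>f. f \<in> F \<Longrightarrow> (\<Sum>s<k. c f s * (1 + t ^ Suc (fst (f s)))) \<noteq> 0"
  proof (rule exists_perturbation_avoiding[OF finF, of "min 1 e" k c "\<lambda>f s. fst (f s)"])
    show "inj_on (\<lambda>s. fst (f s)) {..<k}" if "f \<in> F" for f using that by (simp add: F_def)
  qed (use e(1) c_nz in auto)
  \<comment> \<open>The face heights: for \<open>v j\<close>, which is \<open>w j\<close> divided by
    \<open>\<mu> j\<close>, the face at level 1 is where \<open>w j\<close> takes the value
    \<open>\<mu> j\<close>.\<close>
  define \<mu> where "\<mu> = (\<lambda>j. 1 + t ^ Suc j)"
  have \<mu>1: "1 \<le> \<mu> j" and \<mu>e: "\<mu> j \<le> exp e" for j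
  proof -
    show "1 \<le> \<mu> j" using t by (simp add: \<mu>_def)
    have "t ^ Suc j \<le> t" using t(1,2) power_le_one[of t j] by (simp add: mult_left_le)
    then show "\<mu> j \<le> exp e" using t(2) exp_ge_add_one_self[of e] unfolding \<mu>_def by linarith
  qed
  define v where "v = (\<lambda>j. (1 / \<mu> j) *\<^sub>R w j)"
  define L where "L = (\<lambda>x. MAX j\<in>{..<q}. \<bar>v j \<bullet> x\<bar>)"
  have q: "{..<q} \<noteq> {}" using W(3)[of 0] w by auto
  have L_ge: "\<bar>v j \<bullet> x\<bar> \<le> L x" if "j < q" for j x using that unfolding L_def by simp
  have L_attained: "\<exists>j<q. L x = \<bar>v j \<bullet> x\<bar>" for x
  proof -
    have "L x \<in> (\<lambda>j. \<bar>v j \<bullet> x\<bar>) ` {..<q}" unfolding L_def by (rule Max_in) (use q in auto)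
    then show ?thesis by auto
  qed
  have v_abs: "\<bar>v j \<bullet> x\<bar> = \<bar>w j \<bullet> x\<bar> / \<mu> j" for j x
    using \<mu>1[of j] by (simp add: v_def abs_mult)
  have PL: "P x \<le> exp (2 * e) * L x" for x
  proof -
    obtain j where j: "j < q" "P x \<le> exp e * (w j \<bullet> x)" using W(3)[of x] w by auto
    have "w j \<bullet> x \<le> \<mu> j * \<bar>v j \<bullet> x\<bar>" using \<mu>1[of j] by (simp add: v_abs)
    also have "\<dots> \<le> exp e * L x" using \<mu>1[of j] L_ge[OF j(1), of x] \<mu>e[of j] by (intro mult_mono) auto
    finally have "exp e * (w j \<bullet> x) \<le> exp e * (exp e * L x)" by (intro mult_left_mono) auto
    with j(2) have "P x \<le> exp e * (exp e * L x)" by (rule order_trans)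
    then show ?thesis by (simp add: exp_double power2_eq_square mult.assoc)
  qed
  have LP: "L x \<le> P x" for x
  proof -
    obtain j where "j < q" "L x = \<bar>v j \<bullet> x\<bar>" using L_attained by blast
    moreover have "\<bar>w j \<bullet> x\<bar> / \<mu> j \<le> \<bar>w j \<bullet> x\<bar>" using \<mu>1[of j] by (simp add: field_simps mult_le_cancel_right1)
    ultimately show ?thesis using w_abs[of j x] v_abs[of j x] by linarith
  qed
  have L: "is_norm L"
    unfolding L_def
  proof (rule is_norm_Max_functionals)
    fix x :: 'a assume "x \<noteq> 0"
    then have "0 < L x" using PL[of x] is_norm_pos[OF P(1), of x] by (smt (verit) exp_gt_zero zero_less_mult_pos)
    then show "\<exists>j\<in>{..<q}. v j \<bullet> x \<noteq> 0" using L_attained[of x] by auto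
  qed (use q in auto)
  have "near (2 * e) P L"
  proof (rule nearI[OF PL])
    show "L x \<le> exp (2 * e) * P x" for x
      using LP[of x] e(1) is_norm_nonneg[OF P(1), of x] by (smt (verit) mult_le_cancel_right1 one_le_exp_iff)
  qed
  then have "near (d / 2 + 2 * e) N L" by (rule near_trans[OF P(2)])
  from near_mono[OF this \<open>is_norm N\<close> L] have nearL: "near d N L" using e(2) by simp
  \<comment> \<open>The margin for robustness: if all \<open>L (x s)\<close> differ from 1 by at
    most \<open>exp e' - 1\<close>, weighting the heights with them cannot cancel the nonzero
    combination.\<close>
  have "eventually (\<lambda>e'. \<forall>f\<in>F. (\<Sum>s<k. \<bar>c f s\<bar> * \<mu> (fst (f s))) * (exp e' - 1)
      < \<bar>\<Sum>s<k. c f s * \<mu> (fst (f s))\<bar>) (at_right 0)"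
  proof (intro eventually_ball_finite finF ballI)
    fix f assume f: "f \<in> F"
    have "((\<lambda>e'. (\<Sum>s<k. \<bar>c f s\<bar> * \<mu> (fst (f s))) * (exp e' - 1))
        \<longlongrightarrow> (\<Sum>s<k. \<bar>c f s\<bar> * \<mu> (fst (f s))) * (exp 0 - 1)) (at_right 0)"
      by (intro tendsto_intros)
    then show "eventually (\<lambda>e'. (\<Sum>s<k. \<bar>c f s\<bar> * \<mu> (fst (f s))) * (exp e' - 1)
        < \<bar>\<Sum>s<k. c f s * \<mu> (fst (f s))\<bar>) (at_right 0)"
      by (rule order_tendstoD(2)) (use t(3)[OF f] in \<open>simp add: \<mu>_def\<close>)
  qed
  moreover have "eventually (\<lambda>e'. e' \<in> {0<..<e}) (at_right 0)"
    using e(1) by (rule eventually_at_right_real)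
  ultimately have "eventually (\<lambda>e'. e' \<in> {0<..<e} \<and> (\<forall>f\<in>F. (\<Sum>s<k. \<bar>c f s\<bar> * \<mu> (fst (f s))) * (exp e' - 1)
      < \<bar>\<Sum>s<k. c f s * \<mu> (fst (f s))\<bar>)) (at_right 0)"
    by (rule eventually_elim2) simp
  then obtain e' where e'': "e' \<in> {0<..<e} \<and> (\<forall>f\<in>F. (\<Sum>s<k. \<bar>c f s\<bar> * \<mu> (fst (f s))) * (exp e' - 1)
      < \<bar>\<Sum>s<k. c f s * \<mu> (fst (f s))\<bar>)"
    using eventually_happens'[OF trivial_limit_at_right_real] by blast
  then have e': "0 < e'" "e' < e" and small: "\<And>f. f \<in> F \<Longrightarrow>
      (\<Sum>s<k. \<bar>c f s\<bar> * \<mu> (fst (f s))) * (exp e' - 1) < \<bar>\<Sum>s<k. c f s * \<mu> (fst (f s))\<bar>"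
    by auto
  have False if M: "near e' L M" and x: "\<And>s. s < k \<Longrightarrow> x s = (\<Sum>i<m. A s i *\<^sub>R u i)" "\<And>s. s < k \<Longrightarrow> M (x s) = 1"
    and sep: "\<And>s t. s < k \<Longrightarrow> t < k \<Longrightarrow> s \<noteq> t \<Longrightarrow> r \<le> norm (x s - x t) \<and> r \<le> norm (x s + x t)"
    for M u x
  proof -
    have Lle: "L (x s) \<le> exp e'" and Lge: "exp (- e') \<le> L (x s)" if "s < k" for s
      using nearD1[OF M, of "x s"] nearD2[OF M, of "x s"] x(2)[OF that]
      by (auto simp: exp_minus field_simps)
    have muL_ge: "exp (- e') \<le> \<mu> j * L (x s)" if "s < k" for s j
      using Lge[OF that] mult_right_mono[OF \<mu>1[of j] is_norm_nonneg[OF L, of "x s"]] by simp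
    have "\<exists>p. p \<in> {..<q} \<times> {-1, 1::real} \<and> snd p * (w (fst p) \<bullet> x s) = \<mu> (fst p) * L (x s)" for s
    proof -
      obtain j where j: "j < q" "L (x s) = \<bar>v j \<bullet> x s\<bar>" using L_attained by blast
      then have "\<mu> j * L (x s) = \<bar>w j \<bullet> x s\<bar>" using \<mu>1[of j] by (simp add: v_abs)
      then show ?thesis using j(1)
        by (intro exI[of _ "(j, if w j \<bullet> x s < 0 then -1 else 1)"]) auto
    qed
    then obtain g where g: "\<And>s. g s \<in> {..<q} \<times> {-1, 1::real}"
      "\<And>s. snd (g s) * (w (fst (g s)) \<bullet> x s) = \<mu> (fst (g s)) * L (x s)" by metis
    define f where "f = restrict g {..<k}"
    have f: "f s = g s" if "s < k" for s using that by (simp add: f_def)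
    have face: "w (fst (g s)) \<bullet> (snd (g s) *\<^sub>R x s) = \<mu> (fst (g s)) * L (x s)" for s using g(2) by simp
    have sign: "snd (g s) = 1 \<or> snd (g s) = -1" for s using g(1)[of s] by auto
    \<comment> \<open>On a common face and after adjusting signs, the functional is at least
      \<open>exp (- e)\<close> at the midpoint, hence so is \<open>P\<close>, against uniform
      convexity at distance \<open>r\<close>. The signs are why the sums \<open>x s + x t\<close>
      must be long too.\<close>
    have "inj_on (\<lambda>s. fst (f s)) {..<k}"
    proof (rule inj_onI, rule ccontr)
      fix s s' assume *: "s \<in> {..<k}" "s' \<in> {..<k}" "fst (f s) = fst (f s')" "s \<noteq> s'"
      then have sk: "s < k" "s' < k" and eq: "fst (g s) = fst (g s')" by (auto simp: f)
      let ?y = "snd (g s) *\<^sub>R x s" and ?y' = "snd (g s') *\<^sub>R x s'"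
      let ?z = "(1/2) *\<^sub>R (?y + ?y')"
      have P_le: "(P (snd (g s) *\<^sub>R x s))\<^sup>2 \<le> exp (6 * e)" if "s < k" for s
      proof -
        have "P (snd (g s) *\<^sub>R x s) = P (x s)" using sign[of s] by (auto simp: is_norm_minus[OF P(1)])
        also have "\<dots> \<le> exp (2 * e) * exp e" using PL[of "x s"] Lle[OF that] e'
          by (meson exp_ge_zero exp_le_cancel_iff less_imp_le mult_left_mono order_trans)
        also have "\<dots> = exp (3 * e)" by (simp flip: exp_add)
        finally have "(P (snd (g s) *\<^sub>R x s))\<^sup>2 \<le> (exp (3 * e))\<^sup>2"
          by (intro power_mono is_norm_nonneg[OF P(1)])
        then show ?thesis by (simp flip: exp_double)
      qed
      have "exp (- e) \<le> (exp (- e') + exp (- e')) / 2" using e' by simp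
      also have "\<dots> \<le> (\<mu> (fst (g s)) * L (x s) + \<mu> (fst (g s)) * L (x s')) / 2"
        using sk by (intro divide_right_mono add_mono muL_ge) auto
      also have "\<dots> = w (fst (g s)) \<bullet> ?z" using face[of s] face[of s'] eq by (simp add: inner_add_right)
      also have "\<dots> \<le> P ?z" using w_abs[of "fst (g s)" ?z] g(1)[of s] by auto
      finally have "(exp (- e))\<^sup>2 \<le> (P ?z)\<^sup>2" by (intro power_mono) auto
      moreover have "(exp (- e))\<^sup>2 = exp (- (2 * e))" using exp_double[of "- e"] by simp
      moreover have "exp (- (6 * e)) \<le> exp (- (2 * e))" using e(1) by simp
      ultimately have "((P ?y)\<^sup>2 + (P ?y')\<^sup>2) / 2 - (P ?z)\<^sup>2 \<le> exp (6 * e) - exp (- (6 * e))"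
        using P_le[OF sk(1)] P_le[OF sk(2)] by argo
      moreover have "norm (- x s - x s') = norm (x s + x s')"
        by (metis diff_conv_add_uminus minus_add_distrib norm_minus_cancel)
      then have "r \<le> norm (?y - ?y')"
        using sep[OF sk *(4)] sign[of s] sign[of s']
          norm_minus_commute[of "x s" "x s'"]
        by auto
      then have "c0 * r\<^sup>2 \<le> c0 * (norm (?y - ?y'))\<^sup>2"
        using r P(3) by (intro mult_left_mono power_mono) auto
      ultimately show False using e(3) P(4)[of ?y ?y'] by argo
    qed
    then have fF: "f \<in> F" using g(1) by (auto simp: F_def f_def)
    \<comment> \<open>The relation makes this sum vanish for every \<open>u\<close>, yet its terms
      are \<open>c f s\<close> times a face height times a value of \<open>L\<close> close to
      1.\<close>
    have "(\<Sum>s<k. c f s * (snd (f s) * (w (fst (f s)) \<bullet> x s)))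
        = (\<Sum>s<k. \<Sum>i<m. (A s i * snd (f s) * c f s) * (w (fst (f s)) \<bullet> u i))"
      by (intro sum.cong refl) (simp add: x(1) inner_sum_right sum_distrib_left mult_ac)
    also have "\<dots> = (\<Sum>i<m. (\<Sum>s<k. (A s i * snd (f s) * c f s) *\<^sub>R w (fst (f s))) \<bullet> u i)"
      by (subst sum.swap) (simp add: inner_sum_left)
    also have "\<dots> = 0" by (simp add: c_vec)
    finally have "(\<Sum>s<k. c f s * (\<mu> (fst (f s)) * L (x s))) = 0" by (simp add: f g(2))
    then have "(\<Sum>s<k. c f s * \<mu> (fst (f s))) = (\<Sum>s<k. c f s * \<mu> (fst (f s)) * (1 - L (x s)))"
      by (simp add: right_diff_distrib sum_subtractf mult.assoc)
    also have "\<bar>\<dots>\<bar> \<le> (\<Sum>s<k. \<bar>c f s * \<mu> (fst (f s)) * (1 - L (x s))\<bar>)" by (rule sum_abs)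
    also have "\<dots> \<le> (\<Sum>s<k. \<bar>c f s\<bar> * \<mu> (fst (f s)) * (exp e' - 1))"
    proof (rule sum_mono)
      fix s assume "s \<in> {..<k}"
      then have "\<bar>1 - L (x s)\<bar> \<le> exp e' - 1"
        using Lle[of s] Lge[of s] cosh_real_ge_1[of e'] by (auto simp: cosh_field_def abs_le_iff)
      then show "\<bar>c f s * \<mu> (fst (f s)) * (1 - L (x s))\<bar> \<le> \<bar>c f s\<bar> * \<mu> (fst (f s)) * (exp e' - 1)"
        using \<mu>1[of "fst (f s)"] by (simp add: abs_mult mult_left_mono)
    qed
    also have "\<dots> = (\<Sum>s<k. \<bar>c f s\<bar> * \<mu> (fst (f s))) * (exp e' - 1)" by (simp add: sum_distrib_right)
    finally show False using small[OF fF] by linarith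
  qed
  then have "\<forall>M. is_norm M \<longrightarrow> near e' L M \<longrightarrow> \<not> (\<exists>u x.
    (\<forall>s<k. x s = (\<Sum>i<m. A s i *\<^sub>R u i) \<and> M (x s) = 1) \<and>
    (\<forall>s<k. \<forall>t<k. s \<noteq> t \<longrightarrow> r \<le> norm (x s - x t) \<and> r \<le> norm (x s + x t)))"
    by blast
  then show "\<exists>L e. is_norm L \<and> near d N L \<and> 0 < e \<and> (\<forall>M. is_norm M \<longrightarrow> near e L M \<longrightarrow> \<not> (\<exists>u x.
    (\<forall>s<k. x s = (\<Sum>i<m. A s i *\<^sub>R u i) \<and> M (x s) = 1) \<and>
    (\<forall>s<k. \<forall>t<k. s \<noteq> t \<longrightarrow> r \<le> norm (x s - x t) \<and> r \<le> norm (x s + x t))))"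
    using L nearL e'(1) by blast
qed

section \<open>Counting unit distances\<close>

interpretation rat_vs: vector_space "\<lambda>(q::rat) (x::'a::real_vector). real_of_rat q *\<^sub>R x"
  by unfold_locales (simp_all add: of_rat_add of_rat_mult algebra_simps)

text \<open>Since \<open>a + b\<close> is at least twice the smaller part, every element of that
  part gains a full unit of the logarithm.\<close>

lemma log_superadditive:
  assumes "0 < a" "0 < b"
  shows "real a * log 2 (real a) + real b * log 2 (real b) + real (min a b)
    \<le> real (a + b) * log 2 (real (a + b))"
proof -
  have *: "real a * log 2 (real a) + real b * log 2 (real b) + real a \<le> real (a + b) * log 2 (real (a + b))"
    if "a \<le> b" "0 < a" for a b :: nat
  proof -
    have "real a * (log 2 (real a) + 1) = real a * log 2 (2 * real a)"
      using that by (simp add: log_mult)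
    also have "\<dots> \<le> real a * log 2 (real (a + b))" using that by (intro mult_left_mono) auto
    finally have "real a * (log 2 (real a) + 1) \<le> real a * log 2 (real (a + b))" .
    moreover have "real b * log 2 (real b) \<le> real b * log 2 (real (a + b))"
      using that by (intro mult_left_mono) auto
    ultimately show ?thesis by (simp add: algebra_simps)
  qed
  show ?thesis using *[of a b] *[of b a] assms by (cases "a \<le> b") (auto simp: min_def add_ac)
qed

text \<open>Cutting along the coordinate of one occurring direction \<open>b\<close> severs only edges in direction \<open>b\<close>,
  and these form a matching.\<close>

lemma independent_directions_edges:
  fixes B P :: "'a::real_vector set"
  assumes B: "finite B" "rat_vs.independent B" and P: "finite P"
  shows "real (\<Sum>b\<in>B. card {p \<in> P. p + b \<in> P}) \<le> real (card P) * log 2 (real (card P))"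
  using P
proof (induction rule: finite_psubset_induct)
  case (psubset P)
  show ?case
  proof (cases "\<exists>b\<in>B. \<exists>p\<in>P. p + b \<in> P")
    case False
    then have "card {p \<in> P. p + b \<in> P} = 0" if "b \<in> B" for b
      using that by (metis (no_types, lifting) Collect_empty_eq card.empty)
    then have "(\<Sum>b\<in>B. card {p \<in> P. p + b \<in> P}) = 0" by (intro sum.neutral) blast
    moreover have "0 \<le> real (card P) * log 2 (real (card P))" by (cases "card P") auto
    ultimately show ?thesis by simp
  next
    case True
    then obtain b p where b: "b \<in> B" and p: "p \<in> P" "p + b \<in> P" by blast
    \<comment> \<open>The \<open>b\<close>-coordinate over a rational basis of the whole space;
      extending \<open>B\<close> makes it additive everywhere, not only on the span of
      \<open>B\<close>.\<close>
    define f where "f = (\<lambda>x. rat_vs.representation (rat_vs.extend_basis B) x b)"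
    have f_add: "f (x + y) = f x + f y" for x y
      using B(2) by (simp add: f_def rat_vs.representation_add rat_vs.independent_extend_basis)
    have f_basis: "f b' = (if b' = b then 1 else 0)" if "b' \<in> B" for b'
      using that B(2) rat_vs.extend_basis_superset[OF B(2)]
      by (auto simp: f_def rat_vs.representation_basis rat_vs.independent_extend_basis)
    \<comment> \<open>The threshold \<open>f p\<close> keeps both parts nonempty, as the coordinate
      of \<open>p + b\<close> is larger by 1.\<close>
    define P1 where "P1 = {x \<in> P. f x \<le> f p}"
    define P2 where "P2 = {x \<in> P. f p < f x}"
    have split: "P = P1 \<union> P2" "P1 \<inter> P2 = {}" by (auto simp: P1_def P2_def)
    have fin: "finite P1" "finite P2" using psubset.hyps by (auto simp: P1_def P2_def)
    have "p \<in> P1" "p + b \<in> P2" using p b by (auto simp: P1_def P2_def f_add f_basis)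
    then have psub: "P1 \<subset> P" "P2 \<subset> P" and pos: "0 < card P1" "0 < card P2"
      using split fin by (auto simp: card_gt_0_iff)
    have card: "card P = card P1 + card P2" using split fin by (simp add: card_Un_disjoint)
    define E where "E = (\<lambda>Q (b::'a). {p \<in> Q. p + b \<in> Q})"
    define C where "C = (\<lambda>b. {x \<in> P1. x + b \<in> P2})"
    have E_eq: "E P b' \<subseteq> E P1 b' \<union> E P2 b' \<union> (if b' = b then C b else {})" if "b' \<in> B" for b'
      using f_basis[OF that] by (auto simp: E_def C_def P1_def P2_def f_add split: if_splits)
    have finE: "finite (E Q b')" if "finite Q" for Q b' using that by (simp add: E_def)
    have finC: "finite (C b)" using fin by (simp add: C_def)
    have "card (C b) \<le> card P1" unfolding C_def by (intro card_mono fin) auto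
    moreover have "card (C b) \<le> card P2"
      by (rule card_inj_on_le[of "\<lambda>x. x + b"]) (use fin in \<open>auto simp: C_def inj_on_def\<close>)
    ultimately have C_le: "card (C b) \<le> min (card P1) (card P2)" by simp
    have "(\<Sum>b'\<in>B. card (E P b')) \<le> (\<Sum>b'\<in>B. card (E P1 b') + card (E P2 b') + (if b' = b then card (C b) else 0))"
    proof (rule sum_mono)
      fix b' assume b': "b' \<in> B"
      have "card (E P b') \<le> card (E P1 b' \<union> E P2 b' \<union> (if b' = b then C b else {}))"
        by (rule card_mono[OF _ E_eq[OF b']]) (use fin finE finC in auto)
      also have "\<dots> \<le> card (E P1 b') + card (E P2 b') + card (if b' = b then C b else {})"
        by (meson add_mono card_Un_le order_refl order_trans)
      finally show "card (E P b') \<le> card (E P1 b') + card (E P2 b') + (if b' = b then card (C b) else 0)"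
        by (cases "b' = b") auto
    qed
    also have "\<dots> = (\<Sum>b'\<in>B. card (E P1 b')) + (\<Sum>b'\<in>B. card (E P2 b')) + card (C b)"
      using B(1) b by (simp add: sum.distrib)
    finally have "real (\<Sum>b'\<in>B. card (E P b'))
        \<le> real ((\<Sum>b'\<in>B. card (E P1 b')) + (\<Sum>b'\<in>B. card (E P2 b')) + min (card P1) (card P2))"
      using C_le by linarith
    also have "\<dots> \<le> real (card P1) * log 2 (real (card P1)) + real (card P2) * log 2 (real (card P2))
        + real (min (card P1) (card P2))"
      using psubset.IH[OF psub(1)] psubset.IH[OF psub(2)] unfolding E_def by simp
    also have "\<dots> \<le> real (card P) * log 2 (real (card P))"
      unfolding card by (rule log_superadditive[OF pos])
    finally show ?thesis unfolding E_def .
  qed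
qed

text \<open>The greedy basis works. Generalising over the threshold \<open>v\<close> carries out the summation by parts
  that compares the two sums on all superlevel sets of \<open>w\<close>.\<close>

lemma (in vector_space) heavy_independent_subset:
  fixes w :: "'b \<Rightarrow> real"
  assumes "finite D" and nonneg: "\<And>x. 0 \<le> w x"
    and rank: "\<And>B S. B \<subseteq> S \<Longrightarrow> S \<subseteq> D \<Longrightarrow> independent B \<Longrightarrow> S \<subseteq> span B \<Longrightarrow> card S \<le> k * card B"
  obtains B where "B \<subseteq> D" "independent B" "sum w D \<le> real k * sum w B"
proof -
  have key: "S \<subseteq> D \<longrightarrow> (\<exists>B\<subseteq>S. independent B \<and> S \<subseteq> span B \<and>
      (\<forall>v. (\<forall>s\<in>S. v \<le> w s) \<longrightarrow> (\<Sum>s\<in>S. w s - v) \<le> real k * (\<Sum>s\<in>B. w s - v)))" if "finite S" for S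
    using that
  \<comment> \<open>Ranking by \<open>- w\<close> inserts the elements from heaviest to lightest, so
    each new \<open>x\<close> is lightest in the current set.\<close>
  proof (induction S rule: finite_ranking_induct[where f = "\<lambda>x. - w x"])
    case empty
    then show ?case by (intro impI exI[of _ "{}"]) (auto simp: independent_empty)
  next
    case (insert x S)
    show ?case
    proof (cases "x \<in> S")
      case True
      then show ?thesis using insert by (simp add: insert_absorb)
    next
      case xS: False
      show ?thesis
      proof
        assume D: "insert x S \<subseteq> D"
        then obtain B where B: "B \<subseteq> S" "independent B" "S \<subseteq> span B"
          "\<And>v. (\<forall>s\<in>S. v \<le> w s) \<Longrightarrow> (\<Sum>s\<in>S. w s - v) \<le> real k * (\<Sum>s\<in>B. w s - v)"
          using insert by auto
        have finB: "finite B" using B(1) insert.hyps(1) finite_subset by blast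
        define B' where "B' = (if x \<in> span B then B else insert x B)"
        have B': "B' \<subseteq> insert x S" "independent B'" "insert x S \<subseteq> span B'" "finite B'"
          using B span_superset[of "insert x B"] span_mono[of B "insert x B"] finB
          by (auto simp: B'_def independent_insertI)
        have wx: "w x \<le> w y" if "y \<in> S" for y using insert.hyps(2)[OF that] by simp
        have sumB: "(\<Sum>s\<in>B. w s - w x) = (\<Sum>s\<in>B'. w s - w x)"
        proof -
          have "x \<notin> B" using B(1) xS by blast
          then show ?thesis using finB by (simp add: B'_def)
        qed
        have le: "(\<Sum>s\<in>insert x S. w s - v) \<le> real k * (\<Sum>s\<in>B'. w s - v)"
          if v: "\<forall>s\<in>insert x S. v \<le> w s" for v
        proof -
          \<comment> \<open>The weights are cut at level \<open>w x\<close>. Above it the induction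
            hypothesis applies with threshold \<open>w x\<close>, where \<open>x\<close> contributes
            0; the layer down to \<open>v\<close> has constant thickness, so only cardinalities
            matter there, and \<open>rank\<close> compares them.\<close>
          have "(\<Sum>s\<in>insert x S. w s - v) = (\<Sum>s\<in>S. w s - w x) + real (card (insert x S)) * (w x - v)"
            using insert.hyps(1) xS by (simp add: sum_subtractf algebra_simps)
          also have "\<dots> \<le> real k * (\<Sum>s\<in>B'. w s - w x) + real (k * card B') * (w x - v)"
          proof (rule add_mono)
            show "(\<Sum>s\<in>S. w s - w x) \<le> real k * (\<Sum>s\<in>B'. w s - w x)"
              using B(4)[of "w x"] wx unfolding sumB by blast
            show "real (card (insert x S)) * (w x - v) \<le> real (k * card B') * (w x - v)"
              using rank[OF B'(1) D B'(2,3)] v by (intro mult_right_mono of_nat_mono) auto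
          qed
          also have "\<dots> = real k * (\<Sum>s\<in>B'. w s - v)" by (simp add: sum_subtractf algebra_simps)
          finally show ?thesis .
        qed
        show "\<exists>B\<subseteq>insert x S. independent B \<and> insert x S \<subseteq> span B \<and>
            (\<forall>v. (\<forall>s\<in>insert x S. v \<le> w s) \<longrightarrow> (\<Sum>s\<in>insert x S. w s - v) \<le> real k * (\<Sum>s\<in>B. w s - v))"
          by (intro exI[of _ B'] conjI allI impI B'(1-3) le)
      qed
    qed
  qed
  from key[OF assms(1)] obtain B where B: "B \<subseteq> D" "independent B"
    and le: "\<forall>v. (\<forall>s\<in>D. v \<le> w s) \<longrightarrow> (\<Sum>s\<in>D. w s - v) \<le> real k * (\<Sum>s\<in>B. w s - v)"
    by auto
  show ?thesis using that[OF B] le[rule_format, of 0] nonneg by simp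
qed

text \<open>Rational relations are encoded as lists so that there are only countably many of these conditions.\<close>

definition dependent_unit_vectors ::
    "rat list list \<times> nat \<times> nat \<times> nat \<Rightarrow> ('a::euclidean_space \<Rightarrow> real) \<Rightarrow> bool" where
  "dependent_unit_vectors = (\<lambda>(A, m, k, n) N. m * DIM('a) < k \<and> (\<exists>u x.
    (\<forall>s<k. x s = (\<Sum>i<m. real_of_rat (A ! s ! i) *\<^sub>R u i) \<and> N (x s) = 1) \<and>
    (\<forall>s<k. \<forall>t<k. s \<noteq> t \<longrightarrow> 1 / real (Suc n) \<le> norm (x s - x t) \<and> 1 / real (Suc n) \<le> norm (x s + x t))))"

text \<open>Every code is harmless: indices beyond the lists yield some rationals, and arbitrary
  coefficients are covered. Codes failing the count \<open>m * DIM('a) < k\<close> denote a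
  condition that never holds.\<close>

lemma avoidable_dependent_unit_vectors:
  "avoidable (dependent_unit_vectors p :: ('a::euclidean_space \<Rightarrow> real) \<Rightarrow> bool)"
proof -
  obtain A m k n where p: "p = (A, m, k, n)" by (cases p)
  show ?thesis
  proof (cases "m * DIM('a) < k")
    case True
    then show ?thesis
      using avoidable_dependent[OF True, of "1 / real (Suc n)" "\<lambda>s i. real_of_rat (A ! s ! i)"]
      by (simp add: p dependent_unit_vectors_def)
  next
    case False
    then have "(dependent_unit_vectors p :: ('a \<Rightarrow> real) \<Rightarrow> bool) = (\<lambda>_. False)"
      by (simp add: p dependent_unit_vectors_def fun_eq_iff)
    then show ?thesis
      unfolding avoidable_def using near_mono[OF near_refl] by (metis less_imp_le zero_less_one)
  qed
qed

text \<open>In a finite set without equal or opposite elements the smallest distance up to sign is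
  positive, so it exceeds some \<open>1 / real (Suc n)\<close> and one of the countably many
  forbidden conditions would apply.\<close>

lemma card_unit_vectors_le_rank:
  fixes N :: "'a::euclidean_space \<Rightarrow> real"
  assumes N: "\<And>p. \<not> dependent_unit_vectors p N"
    and S: "finite S" "\<And>x. x \<in> S \<Longrightarrow> N x = 1" "\<And>x y. x \<in> S \<Longrightarrow> y \<in> S \<Longrightarrow> x + y \<noteq> 0"
    and B: "B \<subseteq> S" "S \<subseteq> rat_vs.span B"
  shows "card S \<le> DIM('a) * card B"
proof (rule ccontr)
  assume neg: "\<not> card S \<le> DIM('a) * card B"
  define k where "k = card S"
  define m where "m = card B"
  have finB: "finite B" using B(1) S(1) finite_subset by blast
  obtain x where x: "bij_betw x {..<k} S"
    using ex_bij_betw_nat_finite[OF S(1)] by (auto simp: k_def atLeast0LessThan)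
  obtain u where u: "bij_betw u {..<m} B"
    using ex_bij_betw_nat_finite[OF finB] by (auto simp: m_def atLeast0LessThan)
  have "\<exists>c. y = (\<Sum>v\<in>B. real_of_rat (c v) *\<^sub>R v)" if "y \<in> S" for y
    using that B(2) rat_vs.span_finite[OF finB] by auto
  then obtain c where c: "\<And>y. y \<in> S \<Longrightarrow> y = (\<Sum>v\<in>B. real_of_rat (c y v) *\<^sub>R v)" by metis
  define A where "A = map (\<lambda>s. map (\<lambda>i. c (x s) (u i)) [0..<m]) [0..<k]"
  have xS: "x s \<in> S" if "s < k" for s using x that by (auto simp: bij_betw_def)
  have rep: "x s = (\<Sum>i<m. real_of_rat (A ! s ! i) *\<^sub>R u i)" if "s < k" for s
  proof -
    have "x s = (\<Sum>v\<in>B. real_of_rat (c (x s) v) *\<^sub>R v)" by (rule c[OF xS[OF that]])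
    also have "\<dots> = (\<Sum>i<m. real_of_rat (c (x s) (u i)) *\<^sub>R u i)"
      by (rule sum.reindex_bij_betw[OF u, symmetric])
    also have "\<dots> = (\<Sum>i<m. real_of_rat (A ! s ! i) *\<^sub>R u i)"
      using that by (intro sum.cong) (auto simp: A_def)
    finally show ?thesis .
  qed
  \<comment> \<open>The entry 1 keeps \<open>G\<close> nonempty when there are no two distinct
    indices.\<close>
  define G where "G = insert 1 ((\<lambda>(s, t). min (norm (x s - x t)) (norm (x s + x t)))
    ` {(s, t). s < k \<and> t < k \<and> s \<noteq> t})"
  have "finite G"
    unfolding G_def by (intro finite.insertI finite_imageI finite_subset[OF _ finite_cartesian_product[of "{..<k}" "{..<k}"]]) auto
  moreover have "0 < g" if g: "g \<in> G" for g
  proof -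
    have "0 < norm (x s - x t)" "0 < norm (x s + x t)" if "s < k" "t < k" "s \<noteq> t" for s t
      using S(3)[OF xS xS, of s t] that x by (auto simp: bij_betw_def inj_on_def)
    then show ?thesis using g by (auto simp: G_def)
  qed
  ultimately have "0 < Min G" by (subst Min_gr_iff) (auto simp: G_def)
  then obtain n where n: "1 / real (Suc n) < Min G" using nat_approx_posE by blast
  have sep: "1 / real (Suc n) \<le> norm (x s - x t)" "1 / real (Suc n) \<le> norm (x s + x t)"
    if "s < k" "t < k" "s \<noteq> t" for s t
  proof -
    have "min (norm (x s - x t)) (norm (x s + x t)) \<in> G" using that by (auto simp: G_def)
    with \<open>finite G\<close> have "Min G \<le> min (norm (x s - x t)) (norm (x s + x t))" by (rule Min_le)
    then show "1 / real (Suc n) \<le> norm (x s - x t)" "1 / real (Suc n) \<le> norm (x s + x t)"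
      using n by auto
  qed
  have "dependent_unit_vectors (A, m, k, n) N"
    unfolding dependent_unit_vectors_def prod.case
  proof (intro conjI exI allI impI)
    show "m * DIM('a) < k" using neg by (simp add: m_def k_def mult.commute)
  qed (fact rep sep S(2)[OF xS])+
  then show False using N by blast
qed

lemma unit_pairs_le:
  assumes K: "K \<in> unit_balls" and N: "\<And>p. \<not> dependent_unit_vectors p (ball_norm K)" and P: "finite P"
  shows "real (unit_pairs K P) \<le> 2 * real (card P) * log 2 (real (card P))"
proof -
  let ?N = "ball_norm K"
  have norm: "is_norm ?N" by (rule is_norm_ball_norm[OF K])
  \<comment> \<open>A half-plane with part of its boundary, containing exactly one of
    \<open>d\<close> and \<open>- d\<close> for nonzero \<open>d\<close>: it orients every pair and
    leaves no antipodal directions.\<close>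
  define H where "H = {d :: real^2. 0 < d $ 1 \<or> d $ 1 = 0 \<and> 0 < d $ 2}"
  have H_or: "d \<in> H \<or> - d \<in> H" if "d \<noteq> 0" for d
    using that by (auto simp: H_def vec_eq_iff forall_2)
  have H_add: "x + y \<noteq> 0" if "x \<in> H" "y \<in> H" for x y
    using that by (auto simp: H_def vec_eq_iff forall_2)
  define D where "D = {d \<in> H. ?N d = 1 \<and> (\<exists>p\<in>P. p + d \<in> P)}"
  define W where "W = (\<lambda>d. {p \<in> P. p + d \<in> P})"
  have "D \<subseteq> (\<lambda>(p, q). q - p) ` (P \<times> P)"
    by (force simp: D_def image_iff algebra_simps)
  then have finD: "finite D" using P finite_subset by blast
  have "{{p, q} | p q. p \<in> P \<and> q \<in> P \<and> ?N (p - q) = 1} \<subseteq> (\<lambda>(d, p). {p, p + d}) ` (SIGMA d:D. W d)"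
  proof clarify
    fix p q assume pq: "p \<in> P" "q \<in> P" "?N (p - q) = 1"
    then have "p - q \<noteq> 0" using is_norm_zero[OF norm] by auto
    then consider "p - q \<in> H" | "q - p \<in> H" using H_or[of "p - q"] by auto
    then show "{p, q} \<in> (\<lambda>(d, p). {p, p + d}) ` (SIGMA d:D. W d)"
    proof cases
      case 1
      then have "(p - q, q) \<in> (SIGMA d:D. W d)" using pq by (auto simp: D_def W_def intro!: bexI[of _ q])
      then show ?thesis by (intro image_eqI[of _ _ "(p - q, q)"]) auto
    next
      case 2
      then have "(q - p, p) \<in> (SIGMA d:D. W d)"
        using pq is_norm_minus[OF norm, of "p - q"] by (auto simp: D_def W_def intro!: bexI[of _ p])
      then show ?thesis by (intro image_eqI[of _ _ "(q - p, p)"]) auto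
    qed
  qed
  moreover have "finite (SIGMA d:D. W d)" using finD P by (auto simp: W_def)
  ultimately have "unit_pairs K P \<le> card (SIGMA d:D. W d)"
    unfolding unit_pairs_def by (meson card_image_le card_mono finite_imageI order_trans)
  also have "\<dots> = (\<Sum>d\<in>D. card (W d))" using finD P by (intro card_SigmaI) (auto simp: W_def)
  finally have "real (unit_pairs K P) \<le> (\<Sum>d\<in>D. real (card (W d)))"
    by (metis of_nat_le_iff of_nat_sum)
  moreover obtain B where B: "B \<subseteq> D" "rat_vs.independent B"
    "(\<Sum>d\<in>D. real (card (W d))) \<le> real 2 * (\<Sum>d\<in>B. real (card (W d)))"
  proof (rule rat_vs.heavy_independent_subset[OF finD, of "\<lambda>d. real (card (W d))" 2])
    fix B S assume "B \<subseteq> S" "S \<subseteq> D" "S \<subseteq> rat_vs.span B"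
    then show "card S \<le> 2 * card B"
      using card_unit_vectors_le_rank[OF N, of S B] finite_subset[OF _ finD] H_add by (auto simp: D_def subset_iff)
  qed auto
  moreover have "(\<Sum>d\<in>B. real (card (W d))) \<le> real (card P) * log 2 (real (card P))"
    using independent_directions_edges[OF finite_subset[OF B(1) finD] B(2) P] by (simp add: W_def)
  ultimately show ?thesis by linarith
qed

text \<open>\<open>Max\<close> is informative only for finite sets, so a uniform bound on
  \<open>unit_pairs\<close> must precede any use of the maximum.\<close>

lemma unit_dist_max_attained:
  assumes "\<And>P. finite P \<Longrightarrow> card P = n \<Longrightarrow> unit_pairs K P \<le> b"
  obtains P where "finite P" "card P = n" "unit_dist_max K n = unit_pairs K P"
proof -
  let ?S = "{unit_pairs K P | P. finite P \<and> card P = n}"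
  obtain P :: "(real^2) set" where "finite P" "card P = n"
    using infinite_arbitrarily_large[OF infinite_UNIV_char_0] by blast
  then have "?S \<noteq> {}" by blast
  moreover have "?S \<subseteq> {..b}" using assms by auto
  then have "finite ?S" using finite_subset by blast
  ultimately have "Max ?S \<in> ?S" by (rule Max_in[rotated])
  then show ?thesis using that by (auto simp: unit_dist_max_def)
qed

text \<open>From 9 > 8 follows \<open>log 2 3 > 3 / 2\<close>, and from 9/4 > 2 follows
  \<open>log 2 (3 / 2) > 1 / 2\<close>.\<close>

lemma log_log_gt_half:
  assumes "3 \<le> n"
  shows "1 / 2 < log 2 (log 2 (real n))"
proof -
  have "3 / 2 < log 2 (3::real)"
    using log_less_cancel_iff[of 2 8 9] log_nat_power[of 2 2 3] log_nat_power[of 3 2 2]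
    by (simp del: log_less_cancel_iff)
  also have "\<dots> \<le> log 2 (real n)" using assms by simp
  finally have *: "3 / 2 < log 2 (real n)" .
  have "log 2 2 < log 2 ((3 / 2 :: real)^2)" by (subst log_less_cancel_iff) (auto simp: power2_eq_square)
  then have "1 / 2 < log 2 (3 / 2 :: real)" by (subst (asm) log_nat_power) auto
  also have "\<dots> < log 2 (log 2 (real n))" using * by (subst log_less_cancel_iff) auto
  finally show ?thesis .
qed

lemma unit_dist_max_less:
  assumes K: "K \<in> unit_balls" "\<And>p. \<not> dependent_unit_vectors p (ball_norm K)" and n: "3 \<le> n"
  shows "real (unit_dist_max K n) < 4 * real n * log 2 (real n) * log 2 (log 2 (real n))"
proof -
  have bound: "real (unit_pairs K P) \<le> 2 * real n * log 2 (real n)" if "finite P" "card P = n" for P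
    using unit_pairs_le[OF K that(1)] that(2) by simp
  have "unit_pairs K P \<le> nat \<lfloor>2 * real n * log 2 (real n)\<rfloor>" if "finite P" "card P = n" for P
    using bound[OF that] by (simp add: le_nat_iff le_floor_iff)
  then obtain P where P: "finite P" "card P = n" "unit_dist_max K n = unit_pairs K P"
    using unit_dist_max_attained by blast
  \<comment> \<open>The constant 4 doubles the 2 of the pair bound to make up for a double logarithm
    known only to exceed 1/2; that inequality is also the source of strictness.\<close>
  have "4 * real n * log 2 (real n) * (1 / 2) < 4 * real n * log 2 (real n) * log 2 (log 2 (real n))"
    using n log_log_gt_half[OF n] by (intro mult_strict_left_mono mult_pos_pos) auto
  then show ?thesis using bound[OF P(1,2)] P(3) by simp
qed

theorem theorem1p1:
  shows "\<exists>C0::real.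
    ub_meager {K \<in> unit_balls. \<not> (\<forall>n::nat. n \<ge> 3 \<longrightarrow>
        real (unit_dist_max K n) < C0 * real n * log 2 (real n) * log 2 (log 2 (real n)))}
    \<and> (\<exists>K \<in> unit_balls. smooth_norm K \<and> strictly_convex_norm K \<and>
        (\<forall>n::nat. n \<ge> 3 \<longrightarrow>
        real (unit_dist_max K n) < C0 * real n * log 2 (real n) * log 2 (log 2 (real n))))"
proof (intro exI[of _ 4] conjI)
  let ?dep = "dependent_unit_vectors :: _ \<Rightarrow> (real^2 \<Rightarrow> real) \<Rightarrow> bool"
  show "ub_meager {K \<in> unit_balls. \<not> (\<forall>n::nat. n \<ge> 3 \<longrightarrow>
      real (unit_dist_max K n) < 4 * real n * log 2 (real n) * log 2 (log 2 (real n)))}"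
    unfolding ub_meager_def
  proof (intro exI[of _ "\<lambda>i. {K \<in> unit_balls. ?dep (from_nat i) (ball_norm K)}"] conjI allI)
    show "ub_nowhere_dense {K \<in> unit_balls. ?dep (from_nat i) (ball_norm K)}" for i
      by (rule ub_nowhere_dense_avoidable[OF avoidable_dependent_unit_vectors])
    have "\<exists>i. ?dep (from_nat i) (ball_norm K)"
      if "K \<in> unit_balls" "3 \<le> n"
        "\<not> real (unit_dist_max K n) < 4 * real n * log 2 (real n) * log 2 (log 2 (real n))" for K n
      using unit_dist_max_less[OF that(1) _ that(2)] that(3) by (metis from_nat_to_nat)
    then show "{K \<in> unit_balls. \<not> (\<forall>n::nat. n \<ge> 3 \<longrightarrow>
        real (unit_dist_max K n) < 4 * real n * log 2 (real n) * log 2 (log 2 (real n)))}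
      \<subseteq> (\<Union>i. {K \<in> unit_balls. ?dep (from_nat i) (ball_norm K)})" by blast
  qed
  \<comment> \<open>Midpoints of unit vectors have norm at most 1, so strict convexity fails exactly
    by equality; the length bound splits the failure into countably many avoidable
    conditions.\<close>
  define T1 where "T1 = (\<lambda>n (N :: real^2 \<Rightarrow> real). \<exists>x y. N x = 1 \<and> N y = 1 \<and>
    N ((1/2) *\<^sub>R (x + y)) = 1 \<and> 1 / real (Suc n) \<le> norm (x - y))"
  define T2 where "T2 = (\<lambda>n (N :: real^2 \<Rightarrow> real). \<forall>t. 0 < t \<longrightarrow> t < 1 \<longrightarrow> (\<exists>x y. N x = 1 \<and> N y = 1 \<and>
    1 / real (Suc n) * t \<le> N (x + t *\<^sub>R y) + N (x - t *\<^sub>R y) - 2))"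
  \<comment> \<open>Coding the disjoint sum of the three countable families as one sequence lets a
    single limit norm escape them all.\<close>
  define T where "T = (\<lambda>i. case from_nat i of Inl p \<Rightarrow> ?dep p | Inr (Inl n) \<Rightarrow> T1 n | Inr (Inr n) \<Rightarrow> T2 n)"
  have "is_norm (norm :: real^2 \<Rightarrow> real)" by (simp add: is_norm_def norm_triangle_ineq)
  moreover have "avoidable (T1 n)" "avoidable (T2 n)" for n
    unfolding T1_def T2_def by (rule avoidable_not_strictly_convex avoidable_not_smooth, simp)+
  then have "avoidable (T i)" for i
    unfolding T_def by (auto split: sum.splits simp: avoidable_dependent_unit_vectors)
  ultimately obtain N where N: "is_norm N" "\<And>i. \<not> T i N" using exists_norm_avoiding by blast
  have N0: "\<not> ?dep p N" and N1: "\<not> T1 n N" and N2: "\<not> T2 n N" for p n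
    using N(2)[of "to_nat (Inl p :: _ + nat + nat)"]
      N(2)[of "to_nat (Inr (Inl n) :: (rat list list \<times> nat \<times> nat \<times> nat) + nat + nat)"]
      N(2)[of "to_nat (Inr (Inr n) :: (rat list list \<times> nat \<times> nat \<times> nat) + nat + nat)"]
    by (simp_all add: T_def)
  define K where "K = {x. N x \<le> 1}"
  have K: "K \<in> unit_balls" "ball_norm K = N" using unit_ball_of_norm[OF N(1)] by (auto simp: K_def)
  have "smooth_norm K"
    unfolding smooth_norm_def K(2)
  proof (intro allI impI is_norm_differentiable[OF N(1)])
    fix r :: real assume "0 < r"
    then obtain n where n: "1 / real (Suc n) < r" using nat_approx_posE by blast
    obtain t where t: "0 < t" "t < 1" "\<And>x y. N x = 1 \<Longrightarrow> N y = 1 \<Longrightarrow>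
        N (x + t *\<^sub>R y) + N (x - t *\<^sub>R y) - 2 < 1 / real (Suc n) * t"
      using N2[of n] unfolding T2_def by (meson not_le)
    have "1 / real (Suc n) * t \<le> r * t" using n t by (intro mult_right_mono) auto
    then show "\<exists>t. 0 < t \<and> t < 1 \<and> (\<forall>x y. N x = 1 \<longrightarrow> N y = 1 \<longrightarrow>
        N (x + t *\<^sub>R y) + N (x - t *\<^sub>R y) - 2 \<le> r * t)"
      using t by (meson less_imp_le less_le_trans)
  qed
  moreover have "strictly_convex_norm K"
    unfolding strictly_convex_norm_def K(2)
  proof (intro allI impI)
    fix x y assume xy: "N x = 1 \<and> N y = 1 \<and> x \<noteq> y"
    then obtain n where "1 / real (Suc n) < norm (x - y)" using nat_approx_posE[of "norm (x - y)"] by auto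
    then have "N ((1/2) *\<^sub>R (x + y)) \<noteq> 1" using N1[of n] xy unfolding T1_def by (meson less_imp_le)
    moreover have "N ((1/2) *\<^sub>R (x + y)) \<le> 1" using is_norm_midpoint[OF N(1), of x y] xy by simp
    ultimately show "N ((1/2) *\<^sub>R (x + y)) < 1" by simp
  qed
  ultimately show "\<exists>K \<in> unit_balls. smooth_norm K \<and> strictly_convex_norm K \<and>
      (\<forall>n::nat. n \<ge> 3 \<longrightarrow>
      real (unit_dist_max K n) < 4 * real n * log 2 (real n) * log 2 (log 2 (real n)))"
    using K N0 unit_dist_max_less by (intro bexI[of _ K]) auto
qed

end
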